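(* Let $0<\theta'\le\theta''$ and $\theta=\min\{1,\theta'\}$. There is a constant $C$ depending only on $\theta'$ and $\theta''$ such that the following holds. If $n\ge1$, $(\mathcal A_n,\mu_n)$ is weakly logarithmic with constants $\theta',\theta''$ and associated Poisson vector $\bar\xi=(\xi_1,\dots,\xi_n)$, $(\mathbb G,+)$ is an abelian group, and $h\colon\mathcal A_n\to\mathbb G$ is an additive function, $h(\sigma)=\sum_{j\le n}h_j(k_j(\sigma))$, then for every subset $A\subset\mathbb G$, $$\mu_n\big(h(\sigma)\notin A+A-A\big)\le C\bigg(P^{\theta}\Big(\sum_{j\le n}h_j(\xi_j)\notin A\Big)+\mathbf 1\{\theta<1\}\,n^{-\theta}\bigg).$$
   Context: Notation: $\mathbb Z_+=\{0,1,2,\dots\}$; $\ell(\bar s)=1s_1+2s_2+\cdots+ns_n$ for $\bar s\in\mathbb Z_+^n$; $P^\theta(\cdot)=(P(\cdot))^\theta$; $A+A-A=\{a+b-c:\ a,b,c\in A\}$. Assemblies: fix positive integers $m_j$, $j\ge1$. An assembly $\sigma$ of size $n$ is a partition of a fixed $n$-point set into nonempty subsets, together with, for each subset of size $j$ of the partition, a choice of one of $m_j$ possible structures; a subset with its structure is called a component. $\mathcal A_n$ is the finite set of all assemblies of size $n$. For $\sigma\in\mathcal A_n$, $k_j(\sigma)$ is the number of components of size $j$ and $\bar k(\sigma)=(k_1(\sigma),\dots,k_n(\sigma))$. Weakly logarithmic: let $\mu_n$ be a probability measure on $\mathcal A_n$. The pair $(\mathcal A_n,\mu_n)$ is weakly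 logarithmic (with constants $0<\theta'\le\theta''$) if there is a random vector $\bar\xi=(\xi_1,\dots,\xi_n)$ on some probability space with probability $P$, whose coordinates are mutually independent Poisson random variables, such that $\mu_n(\bar k(\sigma)=\bar s)=P(\bar\xi=\bar s\mid \ell(\bar\xi)=n)$ for each $\bar s\in\mathbb Z_+^n$ and $\theta'/j\le\lambda_j:=\mathbf E\xi_j\le\theta''/j$ for all $j$. Additive function: given an abelian group $(\mathbb G,+)$ and $h_j(s)\in\mathbb G$ for $j\in\mathbb N$, $s\in\mathbb Z_+$, with $h_j(0)=0$ for each $j$, the map $h(\sigma)=\sum_{j\le n}h_j(k_j(\sigma))$ on $\mathcal A_n$ is called an additive function. *)

theory Defs
  imports "HOL-Probability.Probability" "HOL-Library.Poly_Mapping"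
begin

text \<open>An assembly on the point set \<open>{1..n}\<close> is the set of its components; a component is a pair
  \<open>(B, s)\<close> of a block \<open>B\<close> of the partition and a structure \<open>s\<close>, the \<open>m j\<close> possible structures on a
  block of size \<open>j\<close> being coded by the numbers \<open>s < m j\<close>. Injectivity of \<open>fst\<close> says that each block
  carries exactly one structure.\<close>

type_synonym assembly = "(nat set \<times> nat) set"

definition assemblies :: "(nat \<Rightarrow> nat) \<Rightarrow> nat \<Rightarrow> assembly set" where
  "assemblies m n = {\<sigma>. partition_on {1..n} (fst ` \<sigma>) \<and> inj_on fst \<sigma> \<and>
     (\<forall>(B, s) \<in> \<sigma>. s < m (card B))}"

definition comp_count :: "nat \<Rightarrow> assembly \<Rightarrow> nat" where
  "comp_count j \<sigma> = card {c \<in> \<sigma>. card (fst c) = j}"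

text \<open>A vector indexed by \<open>1, \<dots>, n\<close> is a function on \<open>nat\<close> of which only the values on \<open>{1..n}\<close> are
  ever used.\<close>

definition total_size :: "nat \<Rightarrow> (nat \<Rightarrow> nat) \<Rightarrow> nat" where
  "total_size n s = (\<Sum>j=1..n. j * s j)"

text \<open>\<open>poisson_vector M n \<xi>\<close>: on the probability space \<open>M\<close>, the variables \<open>\<xi> 1, \<dots>, \<xi> n\<close> are mutually
  independent and Poisson. (The library specifies \<open>poisson_pmf l\<close> for \<open>l > 0\<close> only.)\<close>

definition poisson_vector :: "'w measure \<Rightarrow> nat \<Rightarrow> (nat \<Rightarrow> 'w \<Rightarrow> nat) \<Rightarrow> bool" where
  "poisson_vector M n \<xi> \<longleftrightarrow>
     prob_space M \<and>
     prob_space.indep_vars M (\<lambda>_. count_space UNIV) \<xi> {1..n} \<and>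
     (\<forall>j\<in>{1..n}. \<exists>l>0. distr M (count_space UNIV) (\<xi> j) = measure_pmf (poisson_pmf l))"

text \<open>The pair of \<open>assemblies m n\<close> and \<open>\<mu>\<close> is weakly logarithmic with constants \<open>\<theta>'\<close>, \<open>\<theta>''\<close>, as
  witnessed by the Poisson vector \<open>\<xi>\<close> on \<open>M\<close>.\<close>

definition weakly_logarithmic ::
  "real \<Rightarrow> real \<Rightarrow> (nat \<Rightarrow> nat) \<Rightarrow> nat \<Rightarrow> assembly measure \<Rightarrow> 'w measure \<Rightarrow> (nat \<Rightarrow> 'w \<Rightarrow> nat) \<Rightarrow> bool"
where
  "weakly_logarithmic \<theta>' \<theta>'' m n \<mu> M \<xi> \<longleftrightarrow>
     (\<forall>j\<ge>1. 0 < m j) \<and>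
     prob_space \<mu> \<and> sets \<mu> = Pow (assemblies m n) \<and>
     poisson_vector M n \<xi> \<and>
     (\<forall>s::nat \<Rightarrow> nat.
        \<P>(\<sigma> in \<mu>. \<forall>j\<in>{1..n}. comp_count j \<sigma> = s j) =
        \<P>(w in M. (\<forall>j\<in>{1..n}. \<xi> j w = s j) \<bar> total_size n (\<lambda>j. \<xi> j w) = n)) \<and>
     (\<forall>j\<in>{1..n}. \<theta>' / real j \<le> prob_space.expectation M (\<lambda>w. real (\<xi> j w)) \<and>
        prob_space.expectation M (\<lambda>w. real (\<xi> j w)) \<le> \<theta>'' / real j)"

definition additive_fun :: "(nat \<Rightarrow> nat \<Rightarrow> 'g::ab_group_add) \<Rightarrow> nat \<Rightarrow> assembly \<Rightarrow> 'g" where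
  "additive_fun h n \<sigma> = (\<Sum>j=1..n. h j (comp_count j \<sigma>))"

definition plus_minus_set :: "'g::ab_group_add set \<Rightarrow> 'g set" where
  "plus_minus_set A = {a + b - c | a b c. a \<in> A \<and> b \<in> A \<and> c \<in> A}"

text \<open>The constant has to be the same for all groups and all sample spaces, but a formula
  \<open>\<exists>C. \<dots>\<close> in which these have types \<open>'g\<close> and \<open>'w\<close> would only give a constant for each choice
  of the types. To express independence of the types, the constant is a closed term
  \<open>bound_constant\<close> depending on \<open>\<theta>'\<close> and \<open>\<theta>''\<close> only: some number for which the estimate holds for
  functions with values in the free abelian group on the pairs \<open>(j, s)\<close>, through which
  all additive functions factor, and for Poisson vectors on the concrete sample space
  \<open>nat \<Rightarrow> nat\<close>. How the number is picked does not affect the meaning of an estimate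
  that uses it for arbitrary \<open>'g\<close> and \<open>'w\<close>; that it exists is part of that estimate.\<close>

definition bound_constant :: "real \<Rightarrow> real \<Rightarrow> real" where
  "bound_constant \<theta>' \<theta>'' = (SOME C.
     \<forall>n\<ge>1. \<forall>m \<mu>. \<forall>(M :: (nat \<Rightarrow> nat) measure) \<xi>.
     \<forall>(h :: nat \<Rightarrow> nat \<Rightarrow> (nat \<times> nat, int) poly_mapping) A.
       weakly_logarithmic \<theta>' \<theta>'' m n \<mu> M \<xi> \<longrightarrow> (\<forall>j\<ge>1. h j 0 = 0) \<longrightarrow>
       \<P>(\<sigma> in \<mu>. additive_fun h n \<sigma> \<notin> plus_minus_set A)
         \<le> C * (\<P>(w in M. (\<Sum>j=1..n. h j (\<xi> j w)) \<notin> A) powr min 1 \<theta>' +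
                of_bool (min 1 \<theta>' < 1) * real n powr (- min 1 \<theta>')))"

end

theory Submission
  imports Defs
begin

text \<open>
  Write \<open>H s = h\<^sub>1(s\<^sub>1) + \<dots> + h\<^sub>n(s\<^sub>n)\<close>, let \<open>\<delta>\<close> be the probability of \<open>H \<xi> \<notin> A\<close>, and let \<open>\<ell>\<close> be the total
  size. The component counts of an assembly are distributed like \<open>\<xi>\<close> given \<open>\<ell> = n\<close>, an event of
  probability about \<open>1/n\<close>, so the task is to bound \<open>n P(H \<xi> \<notin> A + A - A, \<ell> = n)\<close> by a multiple of
  \<open>\<delta> powr \<theta>\<close> rather than by the trivial \<open>n \<delta>\<close>.

  The factor \<open>n\<close> is spent on choosing a component size. On \<open>\<ell> = n\<close> one has \<open>n = \<Sum> j k\<close> over the pairs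
  \<open>(j, k)\<close> with \<open>s\<^sub>j = k \<ge> 1\<close>, and deleting these \<open>k\<close> components of size \<open>j\<close> turns the Poisson
  probability of \<open>s\<close> into \<open>l\<^sub>j\<^sup>k / k!\<close> times that of a configuration of total size \<open>n - j k\<close>, where
  \<open>l\<^sub>j\<close> is the mean of \<open>\<xi>\<^sub>j\<close>. The weights \<open>j k l\<^sub>j\<^sup>k / k!\<close> are summable over \<open>k\<close>, uniformly in \<open>j\<close>, so
  instead of one value of \<open>\<ell>\<close> a weighted sum over all values below \<open>n\<close> appears.

  Call \<open>(j, k)\<close> a breaking pair if no \<open>t\<close> with \<open>t\<^sub>j = 0\<close> has both \<open>H t\<close> and \<open>H t + h\<^sub>j(k)\<close> in \<open>A\<close>. For any
  other pair, with such a \<open>t\<close>, the identity \<open>H s = H s' + (H t + h\<^sub>j(k)) - H t\<close>, where \<open>s'\<close> is \<open>s\<close> with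
  coordinate \<open>j\<close> set to zero, shows that \<open>H s \<notin> A + A - A\<close> forces \<open>H s' \<notin> A\<close>. Summed over all total
  sizes below \<open>n\<close>, these pairs contribute \<open>O(\<delta>)\<close>.

  Breaking pairs are rare: whenever \<open>\<xi>\<^sub>j = k\<close> for a breaking pair, \<open>H\<close> is outside \<open>A\<close> either at \<open>\<xi>\<close> or after
  coordinate \<open>j\<close> is set to zero. Hence the probability that \<open>\<xi>\<close> realises some breaking pair is
  \<open>O(\<delta>)\<close>, and so is, for small \<open>\<delta>\<close>, the sum of \<open>l\<^sub>j\<^sup>k / k!\<close> over these pairs
  (\<open>sum_prob_flip_le\<close>, \<open>sum_flip_weights_le\<close>). Their contribution is weighted with
  \<open>P(\<ell> = i) = O((i + 1) powr (\<theta> - 1) * n powr (- \<theta>))\<close> at \<open>i = n - j k\<close> (\<open>prob_size_le\<close>), which for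
  \<open>\<theta> < 1\<close> is largest near \<open>i = 0\<close>. Using summability of the weights for \<open>i + 1 \<le> n \<delta>\<close>, and rarity of
  the breaking pairs for larger \<open>i\<close>, one obtains \<open>O(\<delta> powr \<theta>)\<close> (\<open>flip_convolution_le\<close>). Together with
  \<open>n P(\<ell> = n) \<ge> const\<close> (\<open>prob_size_n_ge\<close>) this is \<open>conditional_bound\<close>.

  The constant so obtained is an explicit function of \<open>\<theta>'\<close> and \<open>\<theta>''\<close>. To pass to \<open>bound_constant\<close>,
  each \<open>h\<close> is compared with the universal additive function \<open>generator\<close> into the free abelian
  group and each sample space with the law of the counts on \<open>nat \<Rightarrow> nat\<close>: additive relations
  between four values of the universal function imply the same relations for \<open>h\<close>
  (\<open>generator_relation\<close>).
\<close>

section \<open>Harmonic sums, power sums and the Poisson mean\<close>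

lemma sum_inverse_ge_ln:
  assumes "1 \<le> m" "m \<le> Suc n"
  shows "ln ((real n + 1) / real m) \<le> (\<Sum>j=m..n. 1 / real j)"
  using assms(2)
proof (induction n)
  case 0
  then show ?case using assms by simp
next
  case (Suc n)
  show ?case
  proof (cases "m = Suc (Suc n)")
    case True
    then show ?thesis by simp
  next
    case False
    with Suc.prems have step: "m \<le> Suc n" by simp
    have "0 < real m" using assms(1) by auto
    have "ln ((real (Suc n) + 1) / real m) = ln ((real n + 1) / real m) + ln (1 + 1 / (real n + 1))"
    proof -
      have "(real (Suc n) + 1) / real m = (real n + 1) / real m * (1 + 1 / (real n + 1))"
        by (simp add: divide_simps add_pos_pos)
      then show ?thesis
        using \<open>0 < real m\<close> by (simp only:) (rule ln_mult_pos, simp_all add: add_pos_nonneg add_nonneg_pos)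
    qed
    also have "ln (1 + 1 / (real n + 1)) \<le> 1 / (real n + 1)"
      by (rule ln_add_one_self_le_self) auto
    also have "ln ((real n + 1) / real m) \<le> (\<Sum>j=m..n. 1 / real j)"
      using step by (rule Suc.IH)
    finally show ?thesis using step assms(1) by (simp add: ac_simps)
  qed
qed

lemma sum_inverse_le_ln:
  assumes "1 \<le> m" "m \<le> n"
  shows "(\<Sum>j=m..n. 1 / real j) \<le> 1 + ln (real n / real m)"
  using assms(2)
proof (induction n rule: dec_induct)
  case base
  then show ?case using assms by simp
next
  case (step k)
  have k: "0 < real k" "0 < real m" using assms(1) step by auto
  have "ln (real k / (real k + 1)) \<le> real k / (real k + 1) - 1"
    using k by (intro ln_le_minus_one) auto
  also have "\<dots> = - (1 / (real k + 1))" using k by (simp add: field_simps)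
  finally have "1 / (real k + 1) \<le> - ln (real k / (real k + 1))" by simp
  also have "\<dots> = ln (real (Suc k) / real m) - ln (real k / real m)"
    using k by (simp add: ln_div ac_simps)
  finally show ?case using step by (simp add: ac_simps)
qed

text \<open>The discrete form of integrating \<open>x powr (\<theta> - 1)\<close>. The induction step is Young's inequality for
  \<open>N\<close> and \<open>N + 1\<close> with exponents \<open>\<theta>\<close> and \<open>1 - \<theta>\<close>.\<close>

lemma sum_powr_le:
  fixes \<theta> :: real
  assumes "0 < \<theta>" "\<theta> \<le> 1"
  shows "(\<Sum>i<N. (real i + 1) powr (\<theta> - 1)) \<le> real N powr \<theta> / \<theta>"
proof (induction N)
  case 0
  then show ?case by simp
next
  case (Suc N)
  let ?x = "real N + 1"
  have "real N powr \<theta> * ?x powr (1 - \<theta>) \<le> \<theta> * real N + (1 - \<theta>) * ?x"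
    using assms by (cases "N = 0") (auto intro!: Youngs_inequality_0)
  then have "real N powr \<theta> * ?x powr (1 - \<theta>) + \<theta> \<le> ?x powr \<theta> * ?x powr (1 - \<theta>)"
    by (simp add: algebra_simps flip: powr_add)
  then have "(real N powr \<theta> + \<theta> * ?x powr (\<theta> - 1)) * ?x powr (1 - \<theta>) \<le> ?x powr \<theta> * ?x powr (1 - \<theta>)"
    by (simp add: algebra_simps flip: powr_add)
  then have "real N powr \<theta> + \<theta> * ?x powr (\<theta> - 1) \<le> ?x powr \<theta>"
    by (rule mult_right_le_imp_le) auto
  then have "(real N powr \<theta> + \<theta> * ?x powr (\<theta> - 1)) / \<theta> \<le> ?x powr \<theta> / \<theta>"
    using assms by (intro divide_right_mono) auto
  with Suc assms show ?case by (simp add: ac_simps add_divide_distrib)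
qed

lemma sum_powr_cutoff_le:
  fixes \<theta> x :: real
  assumes "0 < \<theta>" "\<theta> \<le> 1" "0 \<le> x"
  shows "(\<Sum>i<N. of_bool (real i + 1 \<le> x) * (real i + 1) powr (\<theta> - 1)) \<le> x powr \<theta> / \<theta>"
proof -
  have "(\<Sum>i<N. of_bool (real i + 1 \<le> x) * (real i + 1) powr (\<theta> - 1))
      = (\<Sum>i\<in>{i. i < N \<and> real i + 1 \<le> x}. (real i + 1) powr (\<theta> - 1))"
    by (intro sum.mono_neutral_cong_right) auto
  also have "\<dots> \<le> (\<Sum>i<nat \<lfloor>x\<rfloor>. (real i + 1) powr (\<theta> - 1))"
    by (intro sum_mono2) (auto, linarith)
  also have "\<dots> \<le> real (nat \<lfloor>x\<rfloor>) powr \<theta> / \<theta>"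
    using assms by (intro sum_powr_le) auto
  also have "\<dots> \<le> x powr \<theta> / \<theta>"
    using assms by (intro divide_right_mono powr_mono2) auto
  finally show ?thesis .
qed

text \<open>The terms are those of \<open>b\<close> times the exponential series, shifted by one.\<close>

lemma sum_size_biased_exp_le:
  fixes b :: real
  assumes "0 \<le> b"
  shows "(\<Sum>k=1..N. real k * b ^ k / fact k) \<le> b * exp b"
proof -
  have "(\<Sum>k=1..N. real k * b ^ k / fact k) = (\<Sum>k<N. b * (b ^ k / fact k))"
  proof -
    have "(\<Sum>k=1..N. real k * b ^ k / fact k) = (\<Sum>k\<in>Suc ` {..<N}. real k * b ^ k / fact k)"
      by (simp add: image_Suc_lessThan)
    also have "\<dots> = (\<Sum>k<N. b * (b ^ k / fact k))"
      by (subst sum.reindex) (auto simp: divide_simps intro!: sum.cong)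
    finally show ?thesis .
  qed
  also have "\<dots> = b * (\<Sum>k<N. b ^ k / fact k)" by (simp add: sum_distrib_left)
  also have "(\<Sum>k<N. b ^ k / fact k) \<le> exp b"
    unfolding exp_def using summable_exp_generic[of b] assms
    by (intro order.trans[OF sum_le_suminf[of _ "{..<N}"]])
       (auto simp: divide_inverse_commute scaleR_conv_of_real)
  finally show ?thesis using assms by (simp add: mult_left_mono)
qed

lemma has_bochner_integral_poisson:
  assumes "0 < l"
  shows "has_bochner_integral (measure_pmf (poisson_pmf l)) real l"
proof (rule has_bochner_integral_nn_integral)
  have "(\<lambda>k. l * exp (- l) * (l ^ k / fact k)) sums (l * exp (- l) * exp l)"
    using exp_converges[of l] by (intro sums_mult) (simp add: divide_inverse_commute)
  moreover have "l * exp (- l) * (l ^ k / fact k) = l ^ Suc k / fact (Suc k) * exp (- l) * real (Suc k)" for k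
    by (simp add: divide_simps)
  ultimately have "(\<lambda>k. l ^ Suc k / fact (Suc k) * exp (- l) * real (Suc k)) sums l"
    by (simp flip: exp_add add: mult.assoc del: fact_Suc power_Suc of_nat_Suc)
  then have sums: "(\<lambda>k. l ^ k / fact k * exp (- l) * real k) sums l"
    by (subst (asm) sums_Suc_iff) simp
  have "(\<integral>\<^sup>+ k. ennreal (real k) \<partial>measure_pmf (poisson_pmf l)) =
      (\<integral>\<^sup>+ k. ennreal (l ^ k / fact k * exp (- l) * real k) \<partial>count_space UNIV)"
    using assms by (simp add: nn_integral_measure_pmf flip: ennreal_mult'')
  also have "\<dots> = ennreal l"
    unfolding nn_integral_count_space_nat using assms sums by (intro suminf_ennreal_eq) auto
  finally show "(\<integral>\<^sup>+ k. ennreal (real k) \<partial>measure_pmf (poisson_pmf l)) = ennreal l" .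
qed (use assms in auto)

section \<open>Independent Poisson counts\<close>

text \<open>The constants \<open>a\<close> and \<open>b\<close> stand for \<open>\<theta>'\<close> and \<open>\<theta>''\<close>, and \<open>l j\<close> for the mean of the \<open>j\<close>-th count.\<close>

locale poisson_counts =
  fixes n :: nat and l :: "nat \<Rightarrow> real" and a b :: real
  assumes n_pos: "1 \<le> n" and a_pos: "0 < a"
    and rate_lower: "\<And>j. j \<in> {1..n} \<Longrightarrow> a / real j \<le> l j"
    and rate_upper: "\<And>j. j \<in> {1..n} \<Longrightarrow> l j \<le> b / real j"
begin

definition law :: "(nat \<Rightarrow> nat) pmf" where
  "law = Pi_pmf {1..n} 0 (\<lambda>j. poisson_pmf (l j))"

abbreviation prob :: "((nat \<Rightarrow> nat) \<Rightarrow> bool) \<Rightarrow> real" where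
  "prob E \<equiv> measure_pmf.prob law {s. E s}"

lemma rate_pos: "j \<in> {1..n} \<Longrightarrow> 0 < l j"
  using rate_lower[of j] a_pos by (auto intro: less_le_trans[of 0 "a / real j"])

lemma rate_le: "j \<in> {1..n} \<Longrightarrow> l j \<le> b"
proof -
  assume j: "j \<in> {1..n}"
  then have "l j * 1 \<le> l j * real j" using rate_pos[of j] by (intro mult_left_mono) auto
  also have "\<dots> \<le> b" using rate_upper[OF j] j by (simp add: field_simps)
  finally show ?thesis by simp
qed

lemma a_le_b: "a \<le> b"
  using rate_lower[of 1] rate_upper[of 1] n_pos by simp

lemma b_pos: "0 < b"
  using a_le_b a_pos by simp

lemma prob_mono: "(\<And>s. E s \<Longrightarrow> F s) \<Longrightarrow> prob E \<le> prob F"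
  by (intro measure_pmf.finite_measure_mono) auto

text \<open>An event of the form \<open>S (s(j := 0))\<close> depends only on the coordinates other than \<open>j\<close>, hence is
  independent of \<open>s j\<close>.\<close>

lemma prob_resample:
  assumes j: "j \<in> {1..n}"
  shows "prob (\<lambda>s. s j \<in> K \<and> S (s(j := 0))) =
    measure_pmf.prob (poisson_pmf (l j)) K *
    measure_pmf.prob (Pi_pmf ({1..n} - {j}) 0 (\<lambda>j. poisson_pmf (l j))) {f. S f}"
proof -
  define q where "q = Pi_pmf ({1..n} - {j}) 0 (\<lambda>j. poisson_pmf (l j))"
  have off: "f j = 0" if "f \<in> set_pmf q" for f
    using that set_Pi_pmf_subset[of "{1..n} - {j}" 0 "\<lambda>j. poisson_pmf (l j)"] unfolding q_def by auto
  have "law = map_pmf (\<lambda>(y, f). f(j := y)) (pair_pmf (poisson_pmf (l j)) q)"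
    using Pi_pmf_insert[of "{1..n} - {j}" j 0 "\<lambda>j. poisson_pmf (l j)"] j
    unfolding law_def q_def by (simp add: insert_absorb)
  then have "prob (\<lambda>s. s j \<in> K \<and> S (s(j := 0))) =
      measure_pmf.prob (pair_pmf (poisson_pmf (l j)) q) {(y, f). y \<in> K \<and> S (f(j := 0))}"
    by (simp add: case_prod_unfold vimage_def)
  also have "\<dots> = measure_pmf.prob (pair_pmf (poisson_pmf (l j)) q) (K \<times> ({f. S f} \<inter> set_pmf q))"
    by (intro measure_eq_AE AE_pmfI) (auto dest: off simp: fun_upd_idem)
  also have "\<dots> = measure_pmf.prob (poisson_pmf (l j)) K * measure_pmf.prob q {f. S f}"
    by (subst measure_pmf_prob_product) (auto simp: measure_Int_set_pmf)
  finally show ?thesis unfolding q_def .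
qed

lemma prob_resample_zero:
  assumes j: "j \<in> {1..n}"
  shows "prob (\<lambda>s. s j = 0 \<and> S s) = exp (- l j) *
    measure_pmf.prob (Pi_pmf ({1..n} - {j}) 0 (\<lambda>j. poisson_pmf (l j))) {f. S f}"
proof -
  have "prob (\<lambda>s. s j = 0 \<and> S s) = prob (\<lambda>s. s j \<in> {0} \<and> S (s(j := 0)))"
    by (intro arg_cong[where f = "measure_pmf.prob law"]) (auto simp: fun_upd_idem)
  then show ?thesis
    using prob_resample[OF j, of "{0}" S] rate_pos[OF j] by (simp add: measure_pmf_single)
qed

text \<open>Replacing the value 0 of one coordinate by \<open>k\<close> changes a Poisson probability by the factor
  \<open>l\<^sup>k / k!\<close>.\<close>

lemma prob_set_coordinate:
  assumes j: "j \<in> {1..n}"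
  shows "prob (\<lambda>s. s j = k \<and> S (s(j := 0))) = l j ^ k / fact k * prob (\<lambda>s. s j = 0 \<and> S s)"
  using prob_resample[OF j, of "{k}" S] prob_resample_zero[OF j, of S] rate_pos[OF j]
  by (simp add: measure_pmf_single)

text \<open>Passing from the law of \<open>s(j := 0)\<close> to the law of \<open>s\<close> costs at most the factor
  \<open>1 / P(s j = 0) \<le> exp b\<close>.\<close>

lemma prob_resample_le:
  assumes j: "j \<in> {1..n}"
  shows "prob (\<lambda>s. s j \<in> K \<and> S (s(j := 0))) \<le>
    measure_pmf.prob (poisson_pmf (l j)) K * (exp b * prob S)"
proof -
  let ?q = "measure_pmf.prob (Pi_pmf ({1..n} - {j}) 0 (\<lambda>j. poisson_pmf (l j))) {f. S f}"
  have "exp (- l j) * ?q \<le> prob S"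
    unfolding prob_resample_zero[OF j, symmetric] by (rule prob_mono) simp
  then have "exp b * (exp (- l j) * ?q) \<le> exp b * prob S"
    by (intro mult_left_mono) auto
  moreover have "?q \<le> exp b * (exp (- l j) * ?q)"
    using rate_le[OF j] mult_right_mono[of 1 "exp (b - l j)" ?q] by (simp add: exp_diff exp_minus field_simps)
  ultimately have "?q \<le> exp b * prob S" by (rule order.trans[rotated])
  then show ?thesis unfolding prob_resample[OF j] by (intro mult_left_mono) auto
qed

lemma prob_all:
  "prob (\<lambda>s. \<forall>j\<in>{1..n}. s j \<in> B j) = (\<Prod>j=1..n. measure_pmf.prob (poisson_pmf (l j)) (B j))"
  using measure_Pi_pmf_Pi[of "{1..n}" 0 "\<lambda>j. poisson_pmf (l j)" B]
  unfolding law_def Pi_def Ball_def by simp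

lemma prob_vanish:
  assumes "D \<subseteq> {1..n}"
  shows "prob (\<lambda>s. \<forall>j\<in>D. s j = 0) = exp (- (\<Sum>j\<in>D. l j))"
proof -
  have "prob (\<lambda>s. \<forall>j\<in>D. s j = 0) = prob (\<lambda>s. \<forall>j\<in>{1..n}. s j \<in> (if j \<in> D then {0} else UNIV))"
    using assms by (intro arg_cong[where f = "measure_pmf.prob law"]) (auto split: if_splits)
  also have "\<dots> = (\<Prod>j=1..n. if j \<in> D then exp (- l j) else 1)"
    unfolding prob_all using rate_pos
    by (intro prod.cong) (auto simp: measure_pmf_single)
  also have "\<dots> = (\<Prod>j\<in>D. exp (- l j))"
    using assms by (intro prod.mono_neutral_cong_right) auto
  also have "\<dots> = exp (- (\<Sum>j\<in>D. l j))"
    using assms by (simp add: exp_sum sum_negf[symmetric] finite_subset)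
  finally show ?thesis .
qed

abbreviation size :: "(nat \<Rightarrow> nat) \<Rightarrow> nat" where
  "size s \<equiv> total_size n s"

lemma size_remove:
  assumes "j \<in> {1..n}"
  shows "size s = size (s(j := 0)) + j * s j"
proof -
  have "size s = j * s j + (\<Sum>i\<in>{1..n} - {j}. i * s i)"
    unfolding total_size_def using assms by (subst sum.remove[of _ j]) auto
  also have "(\<Sum>i\<in>{1..n} - {j}. i * s i) = size (s(j := 0))"
    unfolding total_size_def using assms by (subst sum.remove[of _ j]) auto
  finally show ?thesis by simp
qed

lemma part_le_size: "j \<in> {1..n} \<Longrightarrow> j * s j \<le> size s"
  using size_remove[of j s] by simp

text \<open>On the event \<open>E\<close> the total size \<open>m\<close> is the sum of \<open>j * k\<close> over the pairs with \<open>s j = k\<close>; taking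
  expectations distributes the factor \<open>m\<close> over these pairs. All \<open>s j\<close> are at most \<open>n\<close> there, which
  makes the range of \<open>k\<close> finite.\<close>

lemma prob_size_decomposition:
  assumes E: "\<And>s. E s \<Longrightarrow> size s = m" and m: "m \<le> n"
  shows "real m * prob E = (\<Sum>j=1..n. \<Sum>k=1..n. real (j * k) * prob (\<lambda>s. E s \<and> s j = k))"
proof -
  have ind: "real m * indicator {s. E s} s =
      (\<Sum>j=1..n. \<Sum>k=1..n. real (j * k) * indicator {s. E s \<and> s j = k} s)" for s
  proof (cases "E s")
    case True
    have "(\<Sum>k=1..n. real (j * k) * indicator {s. E s \<and> s j = k} s) = real (j * s j)" if "j \<in> {1..n}" for j
    proof -
      have "s j \<le> j * s j" using that by simp
      also have "\<dots> \<le> n" using part_le_size[OF that, of s] E[OF True] m by simp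
      finally have "s j \<le> n" .
      have "(\<Sum>k=1..n. real (j * k) * indicator {s. E s \<and> s j = k} s)
          = (\<Sum>k=1..n. if k = s j then real (j * k) else 0)"
        using True by (intro sum.cong) auto
      also have "\<dots> = real (j * s j)" using \<open>s j \<le> n\<close> by auto
      finally show ?thesis .
    qed
    then have "(\<Sum>j=1..n. \<Sum>k=1..n. real (j * k) * indicator {s. E s \<and> s j = k} s) = real (size s)"
      unfolding total_size_def of_nat_sum by (intro sum.cong refl)
    then show ?thesis using True E by simp
  qed simp
  have int: "integrable (measure_pmf law) (\<lambda>s. c * indicator A s)" for c :: real and A
    by (intro integrable_mult_right integrable_real_indicator)
       (auto simp: measure_pmf.emeasure_eq_measure)
  have "real m * prob E = measure_pmf.expectation law (\<lambda>s. real m * indicator {s. E s} s)"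
    by simp
  also have "\<dots> = (\<Sum>j=1..n. \<Sum>k=1..n. measure_pmf.expectation law (\<lambda>s. real (j * k) * indicator {s. E s \<and> s j = k} s))"
    unfolding ind
    by (rule trans[OF Bochner_Integration.integral_sum sum.cong[OF refl Bochner_Integration.integral_sum]])
       (intro Bochner_Integration.integrable_sum int)+
  finally show ?thesis by simp
qed

lemma prob_remove_part:
  assumes j: "j \<in> {1..n}"
  shows "prob (\<lambda>s. S (s(j := 0)) \<and> size s = m \<and> s j = k) =
    (if j * k \<le> m then l j ^ k / fact k * prob (\<lambda>s. s j = 0 \<and> S s \<and> size s = m - j * k) else 0)"
proof (cases "j * k \<le> m")
  case True
  have "prob (\<lambda>s. S (s(j := 0)) \<and> size s = m \<and> s j = k)
      = prob (\<lambda>s. s j = k \<and> S (s(j := 0)) \<and> size (s(j := 0)) = m - j * k)"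
  proof (intro arg_cong[where f = "measure_pmf.prob law"] Collect_cong)
    fix s
    show "S (s(j := 0)) \<and> size s = m \<and> s j = k \<longleftrightarrow>
        s j = k \<and> S (s(j := 0)) \<and> size (s(j := 0)) = m - j * k"
      using True size_remove[OF j, of s] by auto
  qed
  also have "\<dots> = l j ^ k / fact k * prob (\<lambda>s. s j = 0 \<and> S s \<and> size s = m - j * k)"
    by (rule prob_set_coordinate[OF j, where S = "\<lambda>s. S s \<and> size s = m - j * k"])
  finally show ?thesis using True by simp
next
  case False
  have "\<not> (size s = m \<and> s j = k)" for s
    using False size_remove[OF j, of s] by auto
  then have "{s. S (s(j := 0)) \<and> size s = m \<and> s j = k} = {}" by blast
  then show ?thesis using False by (simp del: Collect_empty_eq)
qed

definition weight :: "nat \<Rightarrow> nat \<Rightarrow> real" where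
  "weight j k = real (j * k) * (l j ^ k / fact k)"

lemma weight_nonneg: "j \<in> {1..n} \<Longrightarrow> 0 \<le> weight j k"
  using rate_pos[of j] by (simp add: weight_def)

lemma weight_le:
  assumes j: "j \<in> {1..n}"
  shows "weight j k \<le> real k * b ^ k / fact k"
proof (cases k)
  case (Suc k')
  have "real j * l j ^ Suc k' = (real j * l j) * l j ^ k'" by simp
  also have "\<dots> \<le> b * b ^ k'"
    using rate_pos[OF j] rate_le[OF j] rate_upper[OF j] j b_pos
    by (intro mult_mono power_mono) (auto simp: field_simps)
  finally have "real j * l j ^ k \<le> b ^ k" using Suc by simp
  then have "real k / fact k * (real j * l j ^ k) \<le> real k / fact k * b ^ k"
    by (intro mult_left_mono) auto
  then show ?thesis by (simp add: weight_def ac_simps)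
qed (simp add: weight_def)

text \<open>For a fixed \<open>k\<close> the numbers \<open>m - j * k\<close> are distinct and less than \<open>m\<close>, so the sum over \<open>j\<close> is at
  most the full sum of \<open>g\<close>; the remaining factors form a convergent series in \<open>k\<close>.\<close>

lemma weighted_convolution_le:
  assumes g: "\<And>i. 0 \<le> g i"
  shows "(\<Sum>j=1..n. \<Sum>k=1..n. if j * k \<le> m then weight j k * g (m - j * k) else 0)
    \<le> b * exp b * (\<Sum>i<m. g i)"
proof -
  have "(\<Sum>j=1..n. \<Sum>k=1..n. if j * k \<le> m then weight j k * g (m - j * k) else 0)
      \<le> (\<Sum>j=1..n. \<Sum>k=1..n. real k * b ^ k / fact k * (if j * k \<le> m then g (m - j * k) else 0))"
  proof (intro sum_mono)
    fix j k assume "j \<in> {1..n}" "k \<in> {1..n}"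
    then show "(if j * k \<le> m then weight j k * g (m - j * k) else 0)
        \<le> real k * b ^ k / fact k * (if j * k \<le> m then g (m - j * k) else 0)"
      using mult_right_mono[OF weight_le g] by simp
  qed
  also have "\<dots> = (\<Sum>k=1..n. real k * b ^ k / fact k * (\<Sum>j=1..n. if j * k \<le> m then g (m - j * k) else 0))"
    by (subst sum.swap) (simp add: sum_distrib_left)
  also have "\<dots> \<le> (\<Sum>k=1..n. real k * b ^ k / fact k * (\<Sum>i<m. g i))"
  proof (intro sum_mono mult_left_mono)
    fix k assume k: "k \<in> {1..n}"
    have inj: "inj_on (\<lambda>j. m - j * k) {j \<in> {1..n}. j * k \<le> m}"
    proof (rule inj_onI)
      fix i j assume "i \<in> {j \<in> {1..n}. j * k \<le> m}" "j \<in> {j \<in> {1..n}. j * k \<le> m}"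
        and "m - i * k = m - j * k"
      moreover from this have "i * k \<le> m" "j * k \<le> m" by auto
      ultimately have "i * k = j * k" by linarith
      then show "i = j" using k by simp
    qed
    have "(\<Sum>j=1..n. if j * k \<le> m then g (m - j * k) else 0) = (\<Sum>j\<in>{j \<in> {1..n}. j * k \<le> m}. g (m - j * k))"
      by (intro sum.mono_neutral_cong_right) auto
    also have "\<dots> = sum g ((\<lambda>j. m - j * k) ` {j \<in> {1..n}. j * k \<le> m})"
      using inj by (simp add: sum.reindex)
    also have "\<dots> \<le> (\<Sum>i<m. g i)"
    proof (intro sum_mono2 image_subsetI)
      fix j assume j: "j \<in> {j \<in> {1..n}. j * k \<le> m}"
      then have "0 < j * k" using k by simp
      moreover have "j * k \<le> m" using j by simp
      ultimately have "m - j * k < m" by linarith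
      then show "m - j * k \<in> {..<m}" by simp
    qed (use g in auto)
    finally show "(\<Sum>j=1..n. if j * k \<le> m then g (m - j * k) else 0) \<le> (\<Sum>i<m. g i)" .
  qed (use b_pos in auto)
  also have "\<dots> = (\<Sum>k=1..n. real k * b ^ k / fact k) * (\<Sum>i<m. g i)"
    by (simp add: sum_distrib_right)
  also have "\<dots> \<le> b * exp b * (\<Sum>i<m. g i)"
    using b_pos g by (intro mult_right_mono sum_size_biased_exp_le sum_nonneg) auto
  finally show ?thesis .
qed

lemma prob_size_less: "(\<Sum>i<m. prob (\<lambda>s. S s \<and> size s = i)) = prob (\<lambda>s. S s \<and> size s < m)"
proof -
  have "prob (\<lambda>s. S s \<and> size s < m) = measure_pmf.prob law (\<Union>i<m. {s. S s \<and> size s = i})"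
    by (intro arg_cong[where f = "measure_pmf.prob law"]) auto
  also have "\<dots> = (\<Sum>i<m. prob (\<lambda>s. S s \<and> size s = i))"
    by (intro measure_pmf.finite_measure_finite_Union) (auto simp: disjoint_family_on_def)
  finally show ?thesis by simp
qed

section \<open>Probabilities of a given total size\<close>

lemma prob_remove_part_le:
  assumes j: "j \<in> {1..n}"
  shows "real (j * k) * prob (\<lambda>s. S (s(j := 0)) \<and> size s = m \<and> s j = k)
    \<le> (if j * k \<le> m then weight j k * prob (\<lambda>s. S s \<and> size s = m - j * k) else 0)"
proof (cases "j * k \<le> m")
  case True
  have "weight j k * prob (\<lambda>s. s j = 0 \<and> S s \<and> size s = m - j * k)
      \<le> weight j k * prob (\<lambda>s. S s \<and> size s = m - j * k)"
    using weight_nonneg[OF j] by (intro mult_left_mono prob_mono) auto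
  then show ?thesis
    unfolding prob_remove_part[OF j] using True by (simp add: weight_def)
next
  case False
  then show ?thesis unfolding prob_remove_part[OF j] by simp
qed

lemma prob_size_recursion:
  assumes "m \<le> n"
  shows "real m * prob (\<lambda>s. size s = m) \<le> b * exp b * prob (\<lambda>s. size s < m)"
proof -
  have "real m * prob (\<lambda>s. size s = m)
      = (\<Sum>j=1..n. \<Sum>k=1..n. real (j * k) * prob (\<lambda>s. True \<and> size s = m \<and> s j = k))"
    using prob_size_decomposition[of "\<lambda>s. size s = m" m] assms by simp
  also have "\<dots> \<le> (\<Sum>j=1..n. \<Sum>k=1..n.
      if j * k \<le> m then weight j k * prob (\<lambda>s. True \<and> size s = m - j * k) else 0)"
    by (intro sum_mono prob_remove_part_le)
  also have "\<dots> \<le> b * exp b * (\<Sum>i<m. prob (\<lambda>s. True \<and> size s = i))"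
    by (rule weighted_convolution_le) simp
  also have "\<dots> = b * exp b * prob (\<lambda>s. size s < m)"
    unfolding prob_size_less by simp
  finally show ?thesis .
qed

text \<open>If the total size is less than \<open>m\<close>, no component has size \<open>m\<close> or more, and
  \<open>l m + \<dots> + l n \<ge> a ln ((n + 1) / m)\<close>.\<close>

lemma prob_size_less_le:
  assumes "1 \<le> m" "m \<le> Suc n"
  shows "prob (\<lambda>s. size s < m) \<le> (real m / (real n + 1)) powr a"
proof -
  have "prob (\<lambda>s. size s < m) \<le> prob (\<lambda>s. \<forall>j\<in>{m..n}. s j = 0)"
  proof (intro prob_mono ballI)
    fix s j assume s: "size s < m" and j: "j \<in> {m..n}"
    have "j * s j \<le> size s" using j assms by (intro part_le_size) auto
    also have "\<dots> < j" using s j by simp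
    finally show "s j = 0" by simp
  qed
  also have "\<dots> = exp (- (\<Sum>j=m..n. l j))"
    using assms by (intro prob_vanish) auto
  also have "\<dots> \<le> exp (- (a * ln ((real n + 1) / real m)))"
  proof -
    have "a * ln ((real n + 1) / real m) \<le> a * (\<Sum>j=m..n. 1 / real j)"
      using sum_inverse_ge_ln[OF assms] a_pos by simp
    also have "\<dots> \<le> (\<Sum>j=m..n. l j)"
      unfolding sum_distrib_left using rate_lower assms by (intro sum_mono) auto
    finally show ?thesis by simp
  qed
  also have "\<dots> = (real m / (real n + 1)) powr a"
    using assms by (simp add: powr_def ln_div algebra_simps)
  finally show ?thesis .
qed

text \<open>For \<open>m \<ge> 1\<close> the recursion gives \<open>P(size = m) = O(P(size < m) / m)\<close>, and \<open>prob_size_less_le\<close> bounds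
  \<open>P(size < m)\<close> by a power of \<open>m / n\<close>. Lowering the exponent from \<open>a\<close> to \<open>min 1 a\<close> makes the
  bound nonincreasing in \<open>m\<close>, as its later use on a range \<open>m + 1 > x\<close> requires.\<close>

lemma prob_size_le:
  assumes m: "m \<le> n" and \<theta>: "\<theta> = min 1 a"
  shows "prob (\<lambda>s. size s = m)
    \<le> (2 * b * exp b + 1) * ((real m + 1) powr (\<theta> - 1) * real n powr (- \<theta>))"
proof (cases "m = 0")
  case True
  have "prob (\<lambda>s. size s = m) \<le> (1 / (real n + 1)) powr a"
    using prob_size_less_le[of 1] True by simp
  also have "\<dots> \<le> (1 / (real n + 1)) powr \<theta>"
    using \<theta> a_pos by (intro powr_mono') auto
  also have "\<dots> \<le> (1 / real n) powr \<theta>"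
    using n_pos \<theta> a_pos by (intro powr_mono2) (auto simp: field_simps)
  also have "\<dots> = real n powr (- \<theta>)"
    by (simp add: powr_divide powr_minus_divide)
  also have "\<dots> \<le> (2 * b * exp b + 1) * real n powr (- \<theta>)"
    using b_pos by (simp add: mult_le_cancel_right1)
  finally show ?thesis using True by simp
next
  case False
  then have m0: "0 < real m" "1 \<le> m" by auto
  have "real m * prob (\<lambda>s. size s = m) \<le> b * exp b * prob (\<lambda>s. size s < m)"
    by (rule prob_size_recursion[OF m])
  also have "\<dots> \<le> b * exp b * (real m / real n) powr \<theta>"
  proof -
    have "prob (\<lambda>s. size s < m) \<le> (real m / (real n + 1)) powr a"
      using m m0 by (intro prob_size_less_le) auto
    also have "\<dots> \<le> (real m / (real n + 1)) powr \<theta>"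
      using m \<theta> a_pos by (intro powr_mono') (auto simp: field_simps)
    also have "\<dots> \<le> (real m / real n) powr \<theta>"
      using n_pos \<theta> a_pos by (intro powr_mono2) (auto simp: field_simps)
    finally show ?thesis using b_pos by (intro mult_left_mono) auto
  qed
  also have "\<dots> = b * exp b * (real m powr \<theta> * real n powr (- \<theta>))"
    using n_pos m0 by (simp add: powr_divide powr_minus_divide)
  finally have "prob (\<lambda>s. size s = m) \<le> b * exp b * (real m powr \<theta> * real n powr (- \<theta>)) / real m"
    using m0 by (simp add: field_simps)
  also have "\<dots> = b * exp b * (real m powr (\<theta> - 1) * real n powr (- \<theta>))"
    using m0 by (simp add: powr_diff)
  also have "\<dots> \<le> b * exp b * ((2 * (real m + 1) powr (\<theta> - 1)) * real n powr (- \<theta>))"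
  proof -
    have "((real m + 1) / real m) powr (1 - \<theta>) \<le> 2 powr (1 - \<theta>)"
      using m0 \<theta> by (intro powr_mono2) (auto simp: field_simps)
    also have "\<dots> \<le> 2 powr 1"
      using \<theta> a_pos by (intro powr_mono) auto
    finally have "(real m + 1) powr (1 - \<theta>) \<le> 2 * real m powr (1 - \<theta>)"
      using m0 by (simp add: powr_divide field_simps)
    then have "1 / real m powr (1 - \<theta>) \<le> 2 * (1 / (real m + 1) powr (1 - \<theta>))"
      using m0 by (simp add: field_simps)
    moreover have "y powr (\<theta> - 1) = 1 / y powr (1 - \<theta>)" for y
      using powr_minus_divide[of y "1 - \<theta>"] by simp
    ultimately have "real m powr (\<theta> - 1) \<le> 2 * (real m + 1) powr (\<theta> - 1)"
      by (simp only:)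
    then show ?thesis using b_pos by (intro mult_left_mono mult_right_mono) auto
  qed
  also have "\<dots> \<le> (2 * b * exp b + 1) * ((real m + 1) powr (\<theta> - 1) * real n powr (- \<theta>))"
    by (simp add: algebra_simps)
  finally show ?thesis .
qed

text \<open>Markov's inequality for the total size on the event that the coordinates in \<open>D\<close> vanish. By
  independence, the expectation of each remaining count on this event is its mean times
  the probability of the event.\<close>

lemma vanish_markov:
  assumes D: "D \<subseteq> {1..n}"
  shows "x * prob (\<lambda>s. (\<forall>j\<in>D. s j = 0) \<and> x \<le> real (size s))
    \<le> exp (- (\<Sum>j\<in>D. l j)) * (\<Sum>j\<in>{1..n} - D. real j * l j)"
proof -
  let ?Z = "{s. \<forall>j\<in>D. s j = 0}"
  define f :: "nat \<Rightarrow> nat \<Rightarrow> nat \<Rightarrow> real" where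
    "f j i = (if i \<in> D then indicator {0} else if i = j then real else (\<lambda>_. 1))" for j i
  have f_prod: "(\<Prod>i=1..n. f j i (s i)) = indicator ?Z s * real (s j)" if "j \<in> {1..n} - D" for j s
  proof -
    have "(\<Prod>i=1..n. f j i (s i)) =
        (\<Prod>i=1..n. (if i \<in> D then indicator {0} (s i) else 1) * (if i = j then real (s i) else 1))"
      using that by (intro prod.cong) (auto simp: f_def)
    also have "\<dots> = (\<Prod>i=1..n. if i \<in> D then indicator {0} (s i) else 1) * real (s j)"
      using that by (simp add: prod.distrib)
    also have "(\<Prod>i=1..n. if i \<in> D then indicator {0} (s i) else 1) = (\<Prod>i\<in>D. indicator {0} (s i) :: real)"
      using D by (intro prod.mono_neutral_cong_right) auto
    also have "\<dots> = indicator ?Z s"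
      using D by (auto simp: indicator_def finite_subset[OF D] intro!: prod.neutral prod_zero)
    finally show ?thesis .
  qed
  have f_int: "integrable (measure_pmf (poisson_pmf (l i))) (f j i)" if "i \<in> {1..n}" for i j
    using has_bochner_integral_poisson[OF rate_pos[OF that]]
    by (auto simp: f_def has_bochner_integral_iff measure_pmf.emeasure_eq_measure)
  have f_exp: "measure_pmf.expectation law (\<lambda>s. \<Prod>i=1..n. f j i (s i)) = exp (- (\<Sum>i\<in>D. l i)) * l j"
    if "j \<in> {1..n} - D" for j
  proof -
    have "measure_pmf.expectation law (\<lambda>s. \<Prod>i=1..n. f j i (s i)) =
        (\<Prod>i=1..n. measure_pmf.expectation (poisson_pmf (l i)) (f j i))"
      unfolding law_def using f_int by (intro expectation_prod_Pi_pmf) (auto simp: f_def)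
    also have "\<dots> = (\<Prod>i=1..n. (if i \<in> D then exp (- l i) else 1) * (if i = j then l j else 1))"
      using that rate_pos has_bochner_integral_poisson[OF rate_pos]
      by (intro prod.cong) (auto simp: f_def measure_pmf_single has_bochner_integral_iff)
    also have "\<dots> = (\<Prod>i=1..n. if i \<in> D then exp (- l i) else 1) * l j"
      using that by (simp add: prod.distrib)
    also have "(\<Prod>i=1..n. if i \<in> D then exp (- l i) else 1) = (\<Prod>i\<in>D. exp (- l i))"
      using D by (intro prod.mono_neutral_cong_right) auto
    also have "\<dots> = exp (- (\<Sum>i\<in>D. l i))"
      using finite_subset[OF D] by (simp add: exp_sum sum_negf[symmetric])
    finally show ?thesis .
  qed
  have prod_int: "integrable (measure_pmf law) (\<lambda>s. \<Prod>i=1..n. f j i (s i))" for j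
    unfolding law_def using f_int by (intro integrable_prod_Pi_pmf) auto
  have "x * prob (\<lambda>s. (\<forall>j\<in>D. s j = 0) \<and> x \<le> real (size s)) =
      measure_pmf.expectation law (\<lambda>s. x * indicator {s. (\<forall>j\<in>D. s j = 0) \<and> x \<le> real (size s)} s)"
    by simp
  also have "\<dots> \<le> measure_pmf.expectation law (\<lambda>s. \<Sum>j\<in>{1..n} - D. real j * (\<Prod>i=1..n. f j i (s i)))"
  proof (rule integral_mono)
    show "x * indicator {s. (\<forall>j\<in>D. s j = 0) \<and> x \<le> real (size s)} s
        \<le> (\<Sum>j\<in>{1..n} - D. real j * (\<Prod>i=1..n. f j i (s i)))" for s
    proof (cases "(\<forall>j\<in>D. s j = 0) \<and> x \<le> real (size s)")
      case True
      then have "x \<le> (\<Sum>j=1..n. real (j * s j))" unfolding total_size_def by simp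
      also have "\<dots> = (\<Sum>j\<in>{1..n} - D. real (j * s j))"
        using True by (intro sum.mono_neutral_right) auto
      also have "\<dots> = (\<Sum>j\<in>{1..n} - D. real j * (\<Prod>i=1..n. f j i (s i)))"
        using True by (intro sum.cong refl) (subst f_prod, auto)
      finally show ?thesis using True by simp
    next
      case False
      then show ?thesis by (auto simp: f_def intro!: sum_nonneg mult_nonneg_nonneg prod_nonneg)
    qed
  qed (auto intro!: prod_int[simplified] Bochner_Integration.integrable_sum simp: measure_pmf.emeasure_eq_measure)
  also have "\<dots> = (\<Sum>j\<in>{1..n} - D. measure_pmf.expectation law (\<lambda>s. real j * (\<Prod>i=1..n. f j i (s i))))"
    by (rule Bochner_Integration.integral_sum) (auto intro: prod_int[simplified])
  also have "\<dots> = (\<Sum>j\<in>{1..n} - D. real j * (exp (- (\<Sum>i\<in>D. l i)) * l j))"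
    by (intro sum.cong refl) (subst integral_mult_right_zero, subst f_exp, auto)
  also have "\<dots> = exp (- (\<Sum>j\<in>D. l j)) * (\<Sum>j\<in>{1..n} - D. real j * l j)"
    by (simp add: sum_distrib_left ac_simps)
  finally show ?thesis .
qed

definition size_floor :: real where
  "size_floor = a / 2 * (exp (- b) * (2 * b + 1) powr (- b))"

lemma size_floor_pos: "0 < size_floor"
  using a_pos b_pos by (simp add: size_floor_def)

text \<open>A configuration with total size \<open>n\<close> is obtained from one with total size below \<open>n - N\<close> and no
  components larger than \<open>N\<close> by adding a single component of size \<open>n - size > N\<close>. With \<open>N\<close>
  about \<open>n / (2 b + 1)\<close>, the absence of components larger than \<open>N\<close> has probability bounded
  below, and given this, Markov's inequality makes a total size below \<open>n - N\<close> at least as likely as not.\<close>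

lemma prob_size_n_ge: "size_floor \<le> real n * prob (\<lambda>s. size s = n)"
proof -
  \<comment> \<open>With this choice \<open>N b \<le> (n - N) / 2\<close>, as Markov's inequality requires, while \<open>n / (N + 1)\<close> stays
    bounded by \<open>2 b + 1\<close>.\<close>
  define N where "N = nat \<lfloor>real n / (2 * b + 1)\<rfloor>"
  let ?D = "{Suc N..n}"
  let ?Z = "\<lambda>s :: nat \<Rightarrow> nat. \<forall>j\<in>?D. s j = 0"
  have N_le: "real N * (2 * b + 1) \<le> real n"
  proof -
    have "real N \<le> real n / (2 * b + 1)" using b_pos by (simp add: N_def)
    then show ?thesis using b_pos by (simp add: field_simps)
  qed
  have N_gt: "real n < (real N + 1) * (2 * b + 1)"
  proof -
    have "real n / (2 * b + 1) < real N + 1" unfolding N_def using b_pos by simp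
    then show ?thesis using b_pos by (simp add: field_simps)
  qed
  have "N < n"
  proof (rule ccontr)
    assume "\<not> N < n"
    then have "real n * (2 * b + 1) \<le> real N * (2 * b + 1)" using b_pos by (intro mult_right_mono) auto
    also note N_le
    finally have "b * real n \<le> 0" by (simp add: algebra_simps)
    moreover have "0 < b * real n" using b_pos n_pos by simp
    ultimately show False by simp
  qed
  have half: "prob ?Z / 2 \<le> prob (\<lambda>s. ?Z s \<and> size s < n - N)"
  proof -
    have "real (n - N) * prob (\<lambda>s. ?Z s \<and> real (n - N) \<le> real (size s))
        \<le> exp (- (\<Sum>j\<in>?D. l j)) * (\<Sum>j\<in>{1..n} - ?D. real j * l j)"
      by (rule vanish_markov) auto
    also have "\<dots> \<le> exp (- (\<Sum>j\<in>?D. l j)) * (real N * b)"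
    proof -
      have "(\<Sum>j\<in>{1..n} - ?D. real j * l j) \<le> (\<Sum>j=1..N. b)"
      proof -
        have "{1..n} - ?D = {1..N}" using \<open>N < n\<close> by auto
        moreover have "real j * l j \<le> b" if "j \<in> {1..N}" for j
          using that rate_upper[of j] \<open>N < n\<close> by (simp add: field_simps)
        ultimately show ?thesis by (simp only:) (rule sum_mono)
      qed
      then show ?thesis by (intro mult_left_mono) simp_all
    qed
    also have "exp (- (\<Sum>j\<in>?D. l j)) = prob ?Z" by (intro prob_vanish[symmetric]) auto
    also have "prob ?Z * (real N * b) \<le> prob ?Z * (real (n - N) / 2)"
      using N_le \<open>N < n\<close> by (intro mult_left_mono) (auto simp: field_simps of_nat_diff)
    finally have "real (n - N) * prob (\<lambda>s. ?Z s \<and> n - N \<le> size s) \<le> real (n - N) * (prob ?Z / 2)"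
      by (simp add: ac_simps)
    then have "prob (\<lambda>s. ?Z s \<and> n - N \<le> size s) \<le> prob ?Z / 2"
      using \<open>N < n\<close> by (simp only: mult_le_cancel_left)
    moreover have "prob ?Z = prob (\<lambda>s. ?Z s \<and> n - N \<le> size s) + prob (\<lambda>s. ?Z s \<and> size s < n - N)"
      by (subst measure_pmf.finite_measure_Union[symmetric])
         (auto intro!: arg_cong[where f = "measure_pmf.prob law"])
    ultimately show ?thesis by simp
  qed
  have Z: "exp (- b) * (2 * b + 1) powr (- b) \<le> prob ?Z"
  proof -
    have "(\<Sum>j\<in>?D. l j) \<le> (\<Sum>j\<in>?D. b * (1 / real j))"
      using rate_upper by (intro sum_mono) auto
    also have "\<dots> = b * (\<Sum>j\<in>?D. 1 / real j)" by (simp add: sum_distrib_left)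
    also have "\<dots> \<le> b * (1 + ln (real n / real (Suc N)))"
      using b_pos \<open>N < n\<close> by (intro mult_left_mono sum_inverse_le_ln) auto
    also have "\<dots> \<le> b * (1 + ln (2 * b + 1))"
      using b_pos N_gt n_pos by (intro mult_left_mono add_left_mono) (auto simp: field_simps)
    finally have "exp (- (b * (1 + ln (2 * b + 1)))) \<le> exp (- (\<Sum>j\<in>?D. l j))" by simp
    also have "exp (- (b * (1 + ln (2 * b + 1)))) = exp (- b) * (2 * b + 1) powr (- b)"
      using b_pos by (simp add: powr_def exp_add[symmetric] algebra_simps)
    also have "exp (- (\<Sum>j\<in>?D. l j)) = prob ?Z" by (intro prob_vanish[symmetric]) auto
    finally show ?thesis .
  qed
  have "size_floor \<le> a * prob (\<lambda>s. ?Z s \<and> size s < n - N)"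
    using half Z a_pos by (simp add: size_floor_def)
  also have "\<dots> \<le> a * (\<Sum>j=1..n. prob (\<lambda>s. s j = 0 \<and> True \<and> size s = n - j * 1))"
  proof (rule mult_left_mono)
    \<comment> \<open>The component to be added has size \<open>n - size s\<close>; it exceeds \<open>N\<close>, so \<open>s\<close> has no component
      of that size yet.\<close>
    have "prob (\<lambda>s. ?Z s \<and> size s < n - N)
        \<le> measure_pmf.prob law (\<Union>j\<in>{1..n}. {s. s j = 0 \<and> True \<and> size s = n - j * 1})"
    proof (intro measure_pmf.finite_measure_mono subsetI)
      fix s assume "s \<in> {s. ?Z s \<and> size s < n - N}"
      then have s: "?Z s" "size s < n - N" by auto
      then have "n - size s \<in> ?D" by auto
      with s show "s \<in> (\<Union>j\<in>{1..n}. {s. s j = 0 \<and> True \<and> size s = n - j * 1})"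
        by (intro UN_I[of "n - size s"]) auto
    qed auto
    also have "\<dots> \<le> (\<Sum>j=1..n. prob (\<lambda>s. s j = 0 \<and> True \<and> size s = n - j * 1))"
      by (rule measure_pmf.finite_measure_subadditive_finite) auto
    finally show "prob (\<lambda>s. ?Z s \<and> size s < n - N)
        \<le> (\<Sum>j=1..n. prob (\<lambda>s. s j = 0 \<and> True \<and> size s = n - j * 1))" .
  qed (use a_pos in auto)
  also have "\<dots> = (\<Sum>j=1..n. a * prob (\<lambda>s. s j = 0 \<and> True \<and> size s = n - j * 1))"
    by (simp add: sum_distrib_left)
  also have "\<dots> \<le> (\<Sum>j=1..n. real (j * 1) * prob (\<lambda>s. True \<and> size s = n \<and> s j = 1))"
  proof (rule sum_mono)
    fix j assume j: "j \<in> {1..n}"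
    have "a \<le> real j * l j" using rate_lower[OF j] j by (simp add: field_simps)
    then have "a * prob (\<lambda>s. s j = 0 \<and> True \<and> size s = n - j * 1)
        \<le> real j * l j * prob (\<lambda>s. s j = 0 \<and> True \<and> size s = n - j * 1)"
      by (intro mult_right_mono) auto
    also have "\<dots> = real (j * 1) * prob (\<lambda>s. True \<and> size s = n \<and> s j = 1)"
      using j by (subst prob_remove_part[OF j, where S = "\<lambda>_. True"]) simp
    finally show "a * prob (\<lambda>s. s j = 0 \<and> True \<and> size s = n - j * 1)
        \<le> real (j * 1) * prob (\<lambda>s. True \<and> size s = n \<and> s j = 1)" .
  qed
  also have "\<dots> \<le> (\<Sum>j=1..n. \<Sum>k=1..n. real (j * k) * prob (\<lambda>s. True \<and> size s = n \<and> s j = k))"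
    using n_pos by (intro sum_mono member_le_sum) auto
  also have "\<dots> = real n * prob (\<lambda>s. size s = n)"
    using prob_size_decomposition[of "\<lambda>s. size s = n" n] by simp
  finally show ?thesis .
qed

section \<open>Rarity of breaking pairs\<close>

definition flip_const :: real where
  "flip_const = 3 * (1 + 2 * exp b)"

lemma flip_const_ge_1: "1 \<le> flip_const"
  by (simp add: flip_const_def)

text \<open>If \<open>s j \<in> K j\<close> for some \<open>j\<close> in \<open>J\<close>, then \<open>Out\<close> holds at \<open>s\<close> or after setting one such coordinate to
  zero. The left-hand side bounds the probability of this from below by independence, the
  right-hand side bounds it from above by a union bound and \<open>prob_resample_le\<close>.\<close>

lemma prob_flip_union_le:
  assumes J: "J \<subseteq> {1..n}"
    and flip: "\<And>s j. j \<in> {1..n} \<Longrightarrow> s j \<in> K j \<Longrightarrow> Out s \<or> Out (s(j := 0))"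
  shows "1 - exp (- (\<Sum>j\<in>J. measure_pmf.prob (poisson_pmf (l j)) (K j)))
    \<le> prob Out * (1 + exp b * (\<Sum>j\<in>J. measure_pmf.prob (poisson_pmf (l j)) (K j)))"
proof -
  let ?p = "\<lambda>j. measure_pmf.prob (poisson_pmf (l j)) (K j)"
  have fin: "finite J" using J finite_subset by auto
  have "prob (\<lambda>s. \<forall>j\<in>J. s j \<notin> K j) = prob (\<lambda>s. \<forall>j\<in>{1..n}. s j \<in> (if j \<in> J then - K j else UNIV))"
    using J by (intro arg_cong[where f = "measure_pmf.prob law"]) (auto split: if_splits)
  also have "\<dots> = (\<Prod>j=1..n. if j \<in> J then 1 - ?p j else 1)"
    unfolding prob_all by (intro prod.cong) (auto simp: measure_pmf.prob_compl[simplified] Compl_eq_Diff_UNIV)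
  also have "\<dots> = (\<Prod>j\<in>J. 1 - ?p j)"
    using J by (intro prod.mono_neutral_cong_right) auto
  also have "\<dots> \<le> (\<Prod>j\<in>J. exp (- ?p j))"
    using exp_ge_add_one_self[of "- ?p _"] by (intro prod_mono) auto
  also have "\<dots> = exp (- (\<Sum>j\<in>J. ?p j))"
    using fin by (simp add: exp_sum sum_negf[symmetric])
  finally have "1 - exp (- (\<Sum>j\<in>J. ?p j)) \<le> 1 - prob (\<lambda>s. \<forall>j\<in>J. s j \<notin> K j)" by simp
  also have "\<dots> = prob (\<lambda>s. \<exists>j\<in>J. s j \<in> K j)"
    by (subst measure_pmf.prob_compl[symmetric]) (auto intro!: arg_cong[where f = "measure_pmf.prob law"])
  also have "\<dots> \<le> measure_pmf.prob law ({s. Out s} \<union> (\<Union>j\<in>J. {s. s j \<in> K j \<and> Out (s(j := 0))}))"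
    using flip J by (intro measure_pmf.finite_measure_mono) (blast, simp)
  also have "\<dots> \<le> prob Out + measure_pmf.prob law (\<Union>j\<in>J. {s. s j \<in> K j \<and> Out (s(j := 0))})"
    by (rule measure_Un_le) auto
  also have "measure_pmf.prob law (\<Union>j\<in>J. {s. s j \<in> K j \<and> Out (s(j := 0))})
      \<le> (\<Sum>j\<in>J. prob (\<lambda>s. s j \<in> K j \<and> Out (s(j := 0))))"
    using fin by (intro measure_pmf.finite_measure_subadditive_finite) auto
  also have "\<dots> \<le> (\<Sum>j\<in>J. ?p j * (exp b * prob Out))"
    using J by (intro sum_mono prob_resample_le) auto
  also have "\<dots> = (\<Sum>j\<in>J. ?p j) * (exp b * prob Out)"
    by (simp add: sum_distrib_right)
  finally show ?thesis by (simp add: algebra_simps)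
qed

text \<open>The union bound is useful only when the sum is bounded in advance, in which case it improves a
  bound by 2 to a bound by \<open>flip_const * prob Out < 1\<close>. Each new index adds at most 1 to the sum,
  so by adding the indices of \<open>J\<close> one at a time the sum never passes from below 1 to above 2.\<close>

lemma sum_prob_flip_le:
  assumes flip: "\<And>s j. j \<in> {1..n} \<Longrightarrow> s j \<in> K j \<Longrightarrow> Out s \<or> Out (s(j := 0))"
    and small: "flip_const * prob Out < 1"
    and J: "J \<subseteq> {1..n}"
  shows "(\<Sum>j\<in>J. measure_pmf.prob (poisson_pmf (l j)) (K j)) \<le> flip_const * prob Out"
proof -
  let ?p = "\<lambda>j. measure_pmf.prob (poisson_pmf (l j)) (K j)"
  have improve: "sum ?p J \<le> flip_const * prob Out" if J: "J \<subseteq> {1..n}" and le: "sum ?p J \<le> 2" for J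
  proof -
    let ?q = "sum ?p J"
    have q: "0 \<le> ?q" by (intro sum_nonneg) auto
    \<comment> \<open>On the range \<open>0 \<le> ?q \<le> 2\<close> the function \<open>1 - exp (- ?q)\<close> is at least \<open>?q / 3\<close>.\<close>
    have "exp (- ?q) \<le> 1 / (1 + ?q)"
      using exp_ge_add_one_self[of ?q] q by (simp add: exp_minus divide_simps)
    moreover have "?q / 3 \<le> 1 - 1 / (1 + ?q)"
    proof -
      have "1 - 1 / (1 + ?q) = ?q / (1 + ?q)" using q by (simp add: field_simps)
      moreover have "?q / 3 \<le> ?q / (1 + ?q)" using q le by (intro divide_left_mono) auto
      ultimately show ?thesis by simp
    qed
    ultimately have "?q / 3 \<le> 1 - exp (- ?q)" by linarith
    also have "\<dots> \<le> prob Out * (1 + exp b * ?q)"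
      by (rule prob_flip_union_le[OF J flip])
    also have "\<dots> \<le> prob Out * (1 + exp b * 2)"
      using le by (intro mult_left_mono add_left_mono) auto
    finally show ?thesis by (simp add: flip_const_def algebra_simps)
  qed
  have "finite J" using J finite_subset by auto
  then have "sum ?p J \<le> 1" using J
  proof (induction J)
    case empty
    then show ?case by simp
  next
    case (insert j J)
    have "sum ?p (insert j J) = ?p j + sum ?p J" using insert by simp
    also have "\<dots> \<le> 1 + 1" using insert by (intro add_mono) auto
    finally have "sum ?p (insert j J) \<le> 2" by simp
    then have "sum ?p (insert j J) \<le> flip_const * prob Out"
      using insert.prems by (intro improve) auto
    with small show ?case by simp
  qed
  then show ?thesis using J by (intro improve) auto
qed

text \<open>The weights \<open>l\<^sup>k / k!\<close> are the Poisson probabilities up to the factor \<open>exp l \<le> exp b\<close>.\<close>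

lemma sum_flip_weights_le:
  assumes flip: "\<And>s j. j \<in> {1..n} \<Longrightarrow> s j \<in> K j \<Longrightarrow> Out s \<or> Out (s(j := 0))"
    and small: "flip_const * prob Out < 1"
  shows "(\<Sum>j=1..n. \<Sum>k=1..n. of_bool (k \<in> K j) * (l j ^ k / fact k)) \<le> exp b * flip_const * prob Out"
proof -
  have "(\<Sum>k=1..n. of_bool (k \<in> K j) * (l j ^ k / fact k))
      \<le> exp b * measure_pmf.prob (poisson_pmf (l j)) (K j)" if j: "j \<in> {1..n}" for j
  proof -
    have "(\<Sum>k=1..n. of_bool (k \<in> K j) * (l j ^ k / fact k))
        = exp (l j) * (\<Sum>k=1..n. of_bool (k \<in> K j) * pmf (poisson_pmf (l j)) k)"
      unfolding sum_distrib_left using rate_pos[OF j]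
      by (intro sum.cong) (auto simp: exp_minus field_simps)
    also have "(\<Sum>k=1..n. of_bool (k \<in> K j) * pmf (poisson_pmf (l j)) k)
        = (\<Sum>k\<in>K j \<inter> {1..n}. pmf (poisson_pmf (l j)) k)"
      by (intro sum.mono_neutral_cong_right) auto
    also have "\<dots> = measure_pmf.prob (poisson_pmf (l j)) (K j \<inter> {1..n})"
      by (simp add: measure_measure_pmf_finite)
    also have "exp (l j) * \<dots> \<le> exp b * measure_pmf.prob (poisson_pmf (l j)) (K j)"
      using rate_le[OF j] by (intro mult_mono measure_pmf.finite_measure_mono) auto
    finally show ?thesis by simp
  qed
  then have "(\<Sum>j=1..n. \<Sum>k=1..n. of_bool (k \<in> K j) * (l j ^ k / fact k))
      \<le> (\<Sum>j=1..n. exp b * measure_pmf.prob (poisson_pmf (l j)) (K j))"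
    by (intro sum_mono)
  also have "\<dots> = exp b * (\<Sum>j=1..n. measure_pmf.prob (poisson_pmf (l j)) (K j))"
    by (simp add: sum_distrib_left)
  also have "\<dots> \<le> exp b * (flip_const * prob Out)"
    by (intro mult_left_mono sum_prob_flip_le[OF flip small]) auto
  finally show ?thesis by (simp add: ac_simps)
qed

text \<open>The factor \<open>P(size = i)\<close> is \<open>O(g i * n powr (- \<theta>))\<close> with \<open>g i = (i + 1) powr (\<theta> - 1)\<close>. Where
  \<open>i + 1 \<le> x\<close>, the membership \<open>k \<in> K j\<close> is dropped and the sum of \<open>g\<close> is \<open>O(x powr \<theta>)\<close>. Elsewhere
  \<open>g i \<le> x powr (\<theta> - 1)\<close>, and \<open>j * k \<le> n\<close> reduces the weights to those of \<open>sum_flip_weights_le\<close>. The two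
  parts balance at \<open>x = n * prob Out\<close>.\<close>

lemma flip_convolution_le:
  assumes flip: "\<And>s j. j \<in> {1..n} \<Longrightarrow> s j \<in> K j \<Longrightarrow> Out s \<or> Out (s(j := 0))"
    and small: "flip_const * prob Out < 1" and \<theta>: "\<theta> = min 1 a"
  shows "(\<Sum>j=1..n. \<Sum>k=1..n. if j * k \<le> n
      then weight j k * (of_bool (k \<in> K j) * prob (\<lambda>s. size s = n - j * k)) else 0)
    \<le> (2 * b * exp b + 1) * (b * exp b / \<theta> + exp b * flip_const) * prob Out powr \<theta>"
proof (cases "prob Out = 0")
  case True
  have zero: "of_bool (k \<in> K j) * (l j ^ k / fact k) = 0" if "j \<in> {1..n}" "k \<in> {1..n}" for j k
  proof -
    have nonneg: "0 \<le> of_bool (k \<in> K j) * (l j ^ k / fact k)" if "j \<in> {1..n}" for j k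
      using rate_pos[OF that] by simp
    have "of_bool (k \<in> K j) * (l j ^ k / fact k) \<le> (\<Sum>k=1..n. of_bool (k \<in> K j) * (l j ^ k / fact k))"
      using that nonneg by (intro member_le_sum) auto
    also have "\<dots> \<le> (\<Sum>j=1..n. \<Sum>k=1..n. of_bool (k \<in> K j) * (l j ^ k / fact k))"
      using that nonneg
      by (intro member_le_sum[where f = "\<lambda>j. \<Sum>k=1..n. of_bool (k \<in> K j) * (l j ^ k / fact k)"] sum_nonneg) auto
    also have "\<dots> \<le> 0"
      using sum_flip_weights_le[OF flip small] True by simp
    finally show ?thesis using nonneg[OF that(1), of k] by simp
  qed
  have "(\<Sum>j=1..n. \<Sum>k=1..n. if j * k \<le> n
      then weight j k * (of_bool (k \<in> K j) * prob (\<lambda>s. size s = n - j * k)) else 0) = 0"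
    using zero by (intro sum.neutral ballI) (auto simp: weight_def)
  then show ?thesis using True by simp
next
  case False
  define g where "g i = (real i + 1) powr (\<theta> - 1)" for i :: nat
  define x where "x = real n * prob Out"
  define c where "c = (2 * b * exp b + 1) * real n powr (- \<theta>)"
  have x: "0 < x" using False n_pos by (simp add: x_def zero_less_measure_iff)
  have \<theta>01: "0 < \<theta>" "\<theta> \<le> 1" using \<theta> a_pos by auto
  have c: "0 \<le> c" using b_pos by (simp add: c_def)
  have g: "0 \<le> g i" for i by (simp add: g_def)
  have cut: "weight j k * (of_bool (k \<in> K j) * prob (\<lambda>s. size s = n - j * k))
      \<le> c * (weight j k * (of_bool (real (n - j * k) + 1 \<le> x) * g (n - j * k)))
        + c * (real n * x powr (\<theta> - 1)) * (of_bool (k \<in> K j) * (l j ^ k / fact k))"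
    if j: "j \<in> {1..n}" and jk: "j * k \<le> n" for j k
  proof (cases "k \<in> K j")
    case True
    have "prob (\<lambda>s. size s = n - j * k) \<le> c * g (n - j * k)"
      using prob_size_le[OF _ \<theta>, of "n - j * k"] by (simp add: c_def g_def ac_simps)
    then have 1: "weight j k * prob (\<lambda>s. size s = n - j * k) \<le> weight j k * (c * g (n - j * k))"
      using weight_nonneg[OF j] by (intro mult_left_mono)
    show ?thesis
    proof (cases "real (n - j * k) + 1 \<le> x")
      case True
      have "0 \<le> c * (real n * x powr (\<theta> - 1)) * (of_bool (k \<in> K j) * (l j ^ k / fact k))"
        using rate_pos[OF j] c by simp
      with 1 True show ?thesis using \<open>k \<in> K j\<close> by (simp add: ac_simps)
    next
      case False
      have "g (n - j * k) \<le> x powr (\<theta> - 1)"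
        unfolding g_def using False x \<theta>01 by (intro powr_mono2') auto
      moreover have "weight j k \<le> real n * (l j ^ k / fact k)"
        unfolding weight_def using jk rate_pos[OF j] by (intro mult_right_mono) (auto simp del: of_nat_mult)
      ultimately have "weight j k * (c * g (n - j * k)) \<le> (real n * (l j ^ k / fact k)) * (c * x powr (\<theta> - 1))"
        using c g weight_nonneg[OF j] rate_pos[OF j] by (intro mult_mono) auto
      with 1 False show ?thesis using \<open>k \<in> K j\<close> by (simp add: ac_simps)
    qed
  next
    case False
    then show ?thesis using c g weight_nonneg[OF j] by simp
  qed
  have "(\<Sum>j=1..n. \<Sum>k=1..n. if j * k \<le> n
      then weight j k * (of_bool (k \<in> K j) * prob (\<lambda>s. size s = n - j * k)) else 0)
    \<le> (\<Sum>j=1..n. \<Sum>k=1..n.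
        c * (if j * k \<le> n then weight j k * (of_bool (real (n - j * k) + 1 \<le> x) * g (n - j * k)) else 0)
        + c * (real n * x powr (\<theta> - 1)) * (of_bool (k \<in> K j) * (l j ^ k / fact k)))"
  proof (intro sum_mono)
    fix j k assume j: "j \<in> {1..n}" and "k \<in> {1..n}"
    then have "0 \<le> c * (real n * x powr (\<theta> - 1)) * (of_bool (k \<in> K j) * (l j ^ k / fact k))"
      using rate_pos[OF j] c by simp
    with cut[OF j, of k] show "(if j * k \<le> n
      then weight j k * (of_bool (k \<in> K j) * prob (\<lambda>s. size s = n - j * k)) else 0)
      \<le> c * (if j * k \<le> n then weight j k * (of_bool (real (n - j * k) + 1 \<le> x) * g (n - j * k)) else 0)
        + c * (real n * x powr (\<theta> - 1)) * (of_bool (k \<in> K j) * (l j ^ k / fact k))"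
      by simp
  qed
  also have "\<dots> = c * (\<Sum>j=1..n. \<Sum>k=1..n. if j * k \<le> n
        then weight j k * (of_bool (real (n - j * k) + 1 \<le> x) * g (n - j * k)) else 0)
      + c * (real n * x powr (\<theta> - 1)) * (\<Sum>j=1..n. \<Sum>k=1..n. of_bool (k \<in> K j) * (l j ^ k / fact k))"
    by (simp only: sum.distrib sum_distrib_left)
  also have "\<dots> \<le> c * (b * exp b * (\<Sum>i<n. of_bool (real i + 1 \<le> x) * g i))
      + c * (real n * x powr (\<theta> - 1)) * (exp b * flip_const * prob Out)"
    using c g
    by (intro add_mono mult_left_mono sum_flip_weights_le[OF flip small]
          weighted_convolution_le[where g = "\<lambda>i. of_bool (real i + 1 \<le> x) * g i"]) auto
  also have "\<dots> \<le> c * (b * exp b * (x powr \<theta> / \<theta>))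
      + c * (real n * x powr (\<theta> - 1)) * (exp b * flip_const * prob Out)"
    unfolding g_def using c b_pos x
    by (intro add_right_mono mult_left_mono sum_powr_cutoff_le \<theta>01) auto
  also have "\<dots> = c * x powr \<theta> * (b * exp b / \<theta> + exp b * flip_const)"
  proof -
    have "real n * x powr (\<theta> - 1) * prob Out = x powr \<theta>"
      using x by (simp add: powr_diff x_def)
    then have "c * (real n * x powr (\<theta> - 1)) * (exp b * flip_const * prob Out)
        = c * (exp b * flip_const) * x powr \<theta>"
      by (metis (no_types, lifting) mult.assoc mult.commute)
    then show ?thesis by (simp add: algebra_simps)
  qed
  also have "c * x powr \<theta> = (2 * b * exp b + 1) * prob Out powr \<theta>"
    using n_pos by (simp add: c_def x_def powr_mult powr_minus)
  finally show ?thesis by (simp add: ac_simps)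
qed

section \<open>The estimate conditioned on the total size\<close>

definition main_const :: real where
  "main_const = (b * exp b + (2 * b * exp b + 1) * (b * exp b / min 1 a + exp b * flip_const)) / size_floor
     + flip_const"

lemma main_const_nonneg: "0 \<le> main_const"
  using b_pos a_pos size_floor_pos flip_const_ge_1 by (simp add: main_const_def)

text \<open>In the application \<open>Out\<close> is \<open>H s \<notin> A\<close>, \<open>Far\<close> is \<open>H s \<notin> A + A - A\<close>, and \<open>K j\<close> is the set of all \<open>k\<close> for
  which \<open>(j, k)\<close> is a breaking pair. Two implications carry the additive structure: a value in \<open>K j\<close> forces \<open>Out\<close> before or after setting the coordinate to zero, and
  a value outside \<open>K j\<close> lets \<open>Out\<close> be inferred from \<open>Far\<close>.\<close>

theorem conditional_bound:
  assumes flip: "\<And>s j. j \<in> {1..n} \<Longrightarrow> s j \<in> K j \<Longrightarrow> Out s \<or> Out (s(j := 0))"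
    and far: "\<And>s j. j \<in> {1..n} \<Longrightarrow> s j \<notin> K j \<Longrightarrow> Far s \<Longrightarrow> Out (s(j := 0))"
  shows "prob (\<lambda>s. Far s \<and> size s = n)
    \<le> main_const * prob Out powr min 1 a * prob (\<lambda>s. size s = n)"
proof -
  define \<theta> where "\<theta> = min 1 a"
  define B where "B = b * exp b"
  define D where "D = (2 * b * exp b + 1) * (b * exp b / \<theta> + exp b * flip_const)"
  let ?d = "prob Out"
  have \<theta>01: "0 < \<theta>" "\<theta> \<le> 1" using a_pos by (auto simp: \<theta>_def)
  have B: "0 \<le> B" using b_pos by (simp add: B_def)
  have D: "0 \<le> D" using b_pos \<theta>01 flip_const_ge_1 by (simp add: D_def)
  have d: "?d \<le> ?d powr \<theta>"
    using powr_mono'[of \<theta> 1 ?d] \<theta>01 by simp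
  have const: "main_const = (B + D) / size_floor + flip_const"
    unfolding main_const_def B_def D_def \<theta>_def ..
  show ?thesis
  \<comment> \<open>If \<open>prob Out\<close> is bounded below, the right-hand side is at least the probability of \<open>size = n\<close>.\<close>
  proof (cases "flip_const * ?d < 1")
    case False
    have "0 \<le> (B + D) / size_floor * ?d" using B D size_floor_pos by simp
    then have "1 \<le> main_const * ?d"
      unfolding const distrib_right using False by linarith
    also have "\<dots> \<le> main_const * ?d powr \<theta>" using d main_const_nonneg by (intro mult_left_mono)
    finally have "1 * prob (\<lambda>s. size s = n) \<le> main_const * ?d powr \<theta> * prob (\<lambda>s. size s = n)"
      by (intro mult_right_mono) auto
    moreover have "prob (\<lambda>s. Far s \<and> size s = n) \<le> prob (\<lambda>s. size s = n)"
      by (rule prob_mono) simp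
    ultimately show ?thesis by (simp add: \<theta>_def)
  next
    case True
    have term_le: "real (j * k) * prob (\<lambda>s. (Far s \<and> size s = n) \<and> s j = k)
        \<le> (if j * k \<le> n then weight j k * prob (\<lambda>s. Out s \<and> size s = n - j * k) else 0)
        + (if j * k \<le> n then weight j k * (of_bool (k \<in> K j) * prob (\<lambda>s. size s = n - j * k)) else 0)"
      if j: "j \<in> {1..n}" and k: "k \<in> {1..n}" for j k
    proof (cases "k \<in> K j")
      case True
      have "prob (\<lambda>s. (Far s \<and> size s = n) \<and> s j = k) \<le> prob (\<lambda>s. True \<and> size s = n \<and> s j = k)"
        by (rule prob_mono) simp
      then have "real (j * k) * prob (\<lambda>s. (Far s \<and> size s = n) \<and> s j = k)
          \<le> (if j * k \<le> n then weight j k * prob (\<lambda>s. True \<and> size s = n - j * k) else 0)"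
        using prob_remove_part_le[OF j, where S = "\<lambda>_. True"] by (blast intro: order.trans mult_left_mono of_nat_0_le_iff)
      then show ?thesis using True weight_nonneg[OF j, of k] by (auto intro: add_increasing)
    next
      case False
      have "prob (\<lambda>s. (Far s \<and> size s = n) \<and> s j = k) \<le> prob (\<lambda>s. Out (s(j := 0)) \<and> size s = n \<and> s j = k)"
        using far[OF j] False by (intro prob_mono) auto
      then have "real (j * k) * prob (\<lambda>s. (Far s \<and> size s = n) \<and> s j = k)
          \<le> (if j * k \<le> n then weight j k * prob (\<lambda>s. Out s \<and> size s = n - j * k) else 0)"
        using prob_remove_part_le[OF j, where S = Out] by (blast intro: order.trans mult_left_mono of_nat_0_le_iff)
      then show ?thesis using False by (simp split: if_splits)
    qed
    have "real n * prob (\<lambda>s. Far s \<and> size s = n)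
        = (\<Sum>j=1..n. \<Sum>k=1..n. real (j * k) * prob (\<lambda>s. (Far s \<and> size s = n) \<and> s j = k))"
      by (rule prob_size_decomposition) auto
    also have "\<dots> \<le> (\<Sum>j=1..n. \<Sum>k=1..n.
        (if j * k \<le> n then weight j k * prob (\<lambda>s. Out s \<and> size s = n - j * k) else 0)
        + (if j * k \<le> n then weight j k * (of_bool (k \<in> K j) * prob (\<lambda>s. size s = n - j * k)) else 0))"
      by (intro sum_mono term_le)
    also have "\<dots> = (\<Sum>j=1..n. \<Sum>k=1..n.
          if j * k \<le> n then weight j k * prob (\<lambda>s. Out s \<and> size s = n - j * k) else 0)
        + (\<Sum>j=1..n. \<Sum>k=1..n.
          if j * k \<le> n then weight j k * (of_bool (k \<in> K j) * prob (\<lambda>s. size s = n - j * k)) else 0)"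
      by (simp only: sum.distrib)
    also have "\<dots> \<le> B * (\<Sum>i<n. prob (\<lambda>s. Out s \<and> size s = i)) + D * ?d powr \<theta>"
      unfolding B_def D_def using flip True
      by (intro add_mono weighted_convolution_le[where g = "\<lambda>i. prob (\<lambda>s. Out s \<and> size s = i)"] flip_convolution_le) (auto simp: \<theta>_def)
    also have "\<dots> \<le> B * ?d powr \<theta> + D * ?d powr \<theta>"
    proof -
      have "(\<Sum>i<n. prob (\<lambda>s. Out s \<and> size s = i)) \<le> ?d"
        unfolding prob_size_less by (rule prob_mono) simp
      with d B show ?thesis by (intro add_right_mono mult_left_mono) auto
    qed
    also have "\<dots> = (B + D) / size_floor * ?d powr \<theta> * size_floor"
      using size_floor_pos by (simp add: field_simps)
    also have "\<dots> \<le> main_const * ?d powr \<theta> * (real n * prob (\<lambda>s. size s = n))"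
      using B D size_floor_pos prob_size_n_ge flip_const_ge_1
      by (intro mult_mono) (auto simp: const)
    finally show ?thesis using n_pos by (simp add: \<theta>_def)
  qed
qed

end

section \<open>From assemblies to Poisson counts\<close>

text \<open>Two vectors agree on \<open>{1..n}\<close> exactly when their truncations are equal, so that laws of vectors
  become measures on the countable set of truncated functions.\<close>

definition truncate :: "nat \<Rightarrow> (nat \<Rightarrow> nat) \<Rightarrow> nat \<Rightarrow> nat" where
  "truncate n s = (\<lambda>j. if j \<in> {1..n} then s j else 0)"

lemma total_size_truncate [simp]: "total_size n (truncate n s) = total_size n s"
  by (auto simp: total_size_def truncate_def intro!: sum.cong)

lemma sum_truncate [simp]: "(\<Sum>j=1..n. h j (truncate n s j)) = (\<Sum>j=1..n. h j (s j))"
  by (auto simp: truncate_def intro!: sum.cong)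

lemma truncate_apply [simp]: "1 \<le> j \<Longrightarrow> j \<le> n \<Longrightarrow> truncate n s j = s j"
  by (simp add: truncate_def)

lemma truncate_eq_iff: "truncate n s = truncate n t \<longleftrightarrow> (\<forall>j\<in>{1..n}. s j = t j)"
  by (auto simp: truncate_def fun_eq_iff)

lemma truncate_set_Pi_pmf:
  assumes "s \<in> set_pmf (Pi_pmf {1..n} 0 p)"
  shows "truncate n s = s"
  using subsetD[OF set_Pi_pmf_subset[of "{1..n}" 0 p] assms] by (auto simp: truncate_def fun_eq_iff)

lemma countable_range_truncate: "countable (range (truncate n))"
proof -
  have "range (truncate n) \<subseteq> (\<lambda>h j. if j \<in> {1..n} then h j else 0) ` (PiE {1..n} (\<lambda>_. UNIV))"
  proof (rule image_subsetI)
    fix s :: "nat \<Rightarrow> nat"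
    show "truncate n s \<in> (\<lambda>h j. if j \<in> {1..n} then h j else 0) ` (PiE {1..n} (\<lambda>_. UNIV))"
      by (rule image_eqI[of _ _ "restrict s {1..n}"]) (auto simp: truncate_def)
  qed
  moreover have "countable (PiE {1..n} (\<lambda>_. UNIV :: nat set))"
    by (intro countable_PiE) auto
  ultimately show ?thesis by (blast intro: countable_subset)
qed

lemma measurable_truncate:
  assumes "\<And>s. {w \<in> space M. \<forall>j\<in>{1..n}. X w j = s j} \<in> sets M"
  shows "(\<lambda>w. truncate n (X w)) \<in> measurable M (count_space UNIV)"
proof -
  have "(\<lambda>w. truncate n (X w)) -` {truncate n s} \<inter> space M = {w \<in> space M. \<forall>j\<in>{1..n}. X w j = s j}" for s
    by (auto simp: truncate_eq_iff)
  then have meas: "(\<lambda>w. truncate n (X w)) \<in> measurable M (count_space (range (truncate n)))"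
    using assms by (subst measurable_count_space_eq_countable[OF countable_range_truncate]) auto
  show ?thesis by (rule measurable_compose[OF meas]) simp
qed

text \<open>Both laws live on a countable set, so equality of the point masses suffices.\<close>

lemma distr_truncate_eqI:
  assumes sets: "\<And>s. {w \<in> space M. \<forall>j\<in>{1..n}. X w j = s j} \<in> sets M"
    and fin: "finite_measure M"
    and pt: "\<And>s. measure M {w \<in> space M. \<forall>j\<in>{1..n}. X w j = s j} = pmf p (truncate n s)"
    and supp: "set_pmf p \<subseteq> range (truncate n)"
  shows "distr M (count_space UNIV) (\<lambda>w. truncate n (X w)) = measure_pmf p"
proof (rule measure_eqI_countable_AE[where \<Omega> = "range (truncate n)"])
  note meas = measurable_truncate[OF sets]
  show "AE x in distr M (count_space UNIV) (\<lambda>w. truncate n (X w)). x \<in> range (truncate n)"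
    using meas by (subst AE_distr_iff) auto
  show "AE x in measure_pmf p. x \<in> range (truncate n)"
    using supp by (intro AE_pmfI) auto
  show "emeasure (distr M (count_space UNIV) (\<lambda>w. truncate n (X w))) {x} = emeasure (measure_pmf p) {x}"
    if x_in: "x \<in> range (truncate n)" for x
  proof -
    obtain s where x: "x = truncate n s" using x_in by auto
    have "(\<lambda>w. truncate n (X w)) -` {truncate n s} \<inter> space M = {w \<in> space M. \<forall>j\<in>{1..n}. X w j = s j}"
      by (auto simp: truncate_eq_iff)
    then have "emeasure (distr M (count_space UNIV) (\<lambda>w. truncate n (X w))) {x}
        = emeasure M {w \<in> space M. \<forall>j\<in>{1..n}. X w j = s j}"
      using meas by (simp add: emeasure_distr x)
    also have "\<dots> = ennreal (pmf p x)"
      using pt[of s] fin by (simp add: finite_measure.emeasure_eq_measure x)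
    finally show ?thesis by (simp add: emeasure_pmf_single)
  qed
qed (auto simp: countable_range_truncate)

lemma prob_distr_truncate:
  assumes "\<And>s. {w \<in> space M. \<forall>j\<in>{1..n}. X w j = s j} \<in> sets M"
    and "distr M (count_space UNIV) (\<lambda>w. truncate n (X w)) = measure_pmf p"
  shows "\<P>(w in M. Q (truncate n (X w))) = measure_pmf.prob p {s. Q s}"
proof -
  have "measure_pmf.prob p {s. Q s} = measure M ((\<lambda>w. truncate n (X w)) -` {s. Q s} \<inter> space M)"
    unfolding assms(2)[symmetric] by (intro measure_distr measurable_truncate assms) auto
  also have "(\<lambda>w. truncate n (X w)) -` {s. Q s} \<inter> space M = {w \<in> space M. Q (truncate n (X w))}" by auto
  finally show ?thesis ..
qed

text \<open>The definition of a Poisson vector only asserts that some parameter exists; it must be the mean.\<close>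

lemma poisson_vector_marginal:
  assumes "poisson_vector M n \<xi>" and j: "j \<in> {1..n}"
  shows "0 < prob_space.expectation M (\<lambda>w. real (\<xi> j w))"
    and "distr M (count_space UNIV) (\<xi> j) =
      measure_pmf (poisson_pmf (prob_space.expectation M (\<lambda>w. real (\<xi> j w))))"
    and "\<xi> j \<in> measurable M (count_space UNIV)"
proof -
  interpret prob_space M using assms by (simp add: poisson_vector_def)
  show meas: "\<xi> j \<in> measurable M (count_space UNIV)"
    using assms by (auto simp: poisson_vector_def indep_vars_def)
  obtain l where l: "0 < l" "distr M (count_space UNIV) (\<xi> j) = measure_pmf (poisson_pmf l)"
    using assms unfolding poisson_vector_def by blast
  have "expectation (\<lambda>w. real (\<xi> j w)) = measure_pmf.expectation (poisson_pmf l) real"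
    unfolding l(2)[symmetric] by (rule integral_distr[symmetric, OF meas]) simp
  also have "\<dots> = l"
    using has_bochner_integral_poisson[OF l(1)] by (simp add: has_bochner_integral_iff)
  finally show "0 < expectation (\<lambda>w. real (\<xi> j w))"
    and "distr M (count_space UNIV) (\<xi> j) = measure_pmf (poisson_pmf (expectation (\<lambda>w. real (\<xi> j w))))"
    using l by simp_all
qed

lemma poisson_vector_sets:
  assumes "poisson_vector M n \<xi>"
  shows "{w \<in> space M. \<forall>j\<in>{1..n}. \<xi> j w = s j} \<in> sets M"
proof -
  have "{w \<in> space M. \<xi> j w = s j} \<in> sets M" if "j \<in> {1..n}" for j
  proof -
    have "\<xi> j -` {s j} \<inter> space M \<in> sets M"
      using poisson_vector_marginal(3)[OF assms that] by (rule measurable_sets) simp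
    also have "\<xi> j -` {s j} \<inter> space M = {w \<in> space M. \<xi> j w = s j}" by auto
    finally show ?thesis .
  qed
  then show ?thesis by (intro sets.sets_Collect_finite_All) auto
qed

lemma distr_poisson_vector:
  fixes M :: "'w measure"
  assumes \<xi>: "poisson_vector M n \<xi>" and n: "1 \<le> n"
  shows "distr M (count_space UNIV) (\<lambda>w. truncate n (\<lambda>j. \<xi> j w)) =
    measure_pmf (Pi_pmf {1..n} 0 (\<lambda>j. poisson_pmf (prob_space.expectation M (\<lambda>w. real (\<xi> j w)))))"
proof -
  interpret prob_space M using \<xi> by (simp add: poisson_vector_def)
  let ?l = "\<lambda>j. expectation (\<lambda>w. real (\<xi> j w))"
  have indep: "indep_vars (\<lambda>_. count_space UNIV) \<xi> {1..n}" using \<xi> by (simp add: poisson_vector_def)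
  show ?thesis
  proof (rule distr_truncate_eqI)
    show "prob {w \<in> space M. \<forall>j\<in>{1..n}. \<xi> j w = s j}
        = pmf (Pi_pmf {1..n} 0 (\<lambda>j. poisson_pmf (?l j))) (truncate n s)" for s
    proof -
      have "{w \<in> space M. \<forall>j\<in>{1..n}. \<xi> j w = s j} = (\<Inter>j\<in>{1..n}. \<xi> j -` {s j} \<inter> space M)"
        using n by auto
      then have "prob {w \<in> space M. \<forall>j\<in>{1..n}. \<xi> j w = s j} = (\<Prod>j=1..n. prob (\<xi> j -` {s j} \<inter> space M))"
        using indep_varsD_finite[OF indep, of "\<lambda>j. {s j}"] n by simp
      also have "\<dots> = (\<Prod>j=1..n. pmf (poisson_pmf (?l j)) (s j))"
      proof (rule prod.cong[OF refl])
        fix j assume j: "j \<in> {1..n}"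
        have "prob (\<xi> j -` {s j} \<inter> space M) = measure (distr M (count_space UNIV) (\<xi> j)) {s j}"
          using poisson_vector_marginal(3)[OF \<xi> j] by (simp add: measure_distr)
        then show "prob (\<xi> j -` {s j} \<inter> space M) = pmf (poisson_pmf (?l j)) (s j)"
          by (simp add: poisson_vector_marginal(2)[OF \<xi> j] measure_pmf_single)
      qed
      also have "\<dots> = pmf (Pi_pmf {1..n} 0 (\<lambda>j. poisson_pmf (?l j))) (truncate n s)"
        by (subst pmf_Pi') (auto simp: truncate_def intro!: prod.cong)
      finally show ?thesis .
    qed
    show "set_pmf (Pi_pmf {1..n} 0 (\<lambda>j. poisson_pmf (?l j))) \<subseteq> range (truncate n)"
      by (metis rangeI subsetI truncate_set_Pi_pmf)
  qed (use poisson_vector_sets[OF \<xi>] finite_measure_axioms in auto)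
qed

locale weakly_log =
  fixes \<theta>' \<theta>'' :: real and m :: "nat \<Rightarrow> nat" and n :: nat and \<mu> :: "assembly measure"
    and M :: "'w measure" and \<xi> :: "nat \<Rightarrow> 'w \<Rightarrow> nat"
  assumes theta_pos: "0 < \<theta>'" and n_ge_1: "1 \<le> n"
    and weakly_log: "weakly_logarithmic \<theta>' \<theta>'' m n \<mu> M \<xi>"
begin

lemma poisson: "poisson_vector M n \<xi>"
  using weakly_log by (simp add: weakly_logarithmic_def)

sublocale poisson_counts n "\<lambda>j. prob_space.expectation M (\<lambda>w. real (\<xi> j w))" \<theta>' \<theta>''
  using theta_pos n_ge_1 weakly_log by unfold_locales (auto simp: weakly_logarithmic_def)

lemma prob_xi: "\<P>(w in M. Q (truncate n (\<lambda>j. \<xi> j w))) = prob Q"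
  unfolding law_def
  by (rule prob_distr_truncate[OF poisson_vector_sets distr_poisson_vector]) (use poisson n_ge_1 in auto)

lemma size_n_possible: "set_pmf law \<inter> {s. size s = n} \<noteq> {}"
proof
  assume "set_pmf law \<inter> {s. size s = n} = {}"
  then have "prob (\<lambda>s. size s = n) = 0" by (simp add: measure_pmf_zero_iff)
  then show False using prob_size_n_ge size_floor_pos by simp
qed

lemma cond_prob_xi:
  "\<P>(w in M. (\<forall>j\<in>{1..n}. \<xi> j w = s j) \<bar> total_size n (\<lambda>j. \<xi> j w) = n) =
    prob (\<lambda>t. (\<forall>j\<in>{1..n}. t j = s j) \<and> size t = n) / prob (\<lambda>t. size t = n)"
proof -
  have "\<P>(w in M. (\<forall>j\<in>{1..n}. \<xi> j w = s j) \<and> total_size n (\<lambda>j. \<xi> j w) = n)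
      = prob (\<lambda>t. (\<forall>j\<in>{1..n}. t j = s j) \<and> size t = n)"
    using prob_xi[of "\<lambda>t. (\<forall>j\<in>{1..n}. t j = s j) \<and> size t = n"] by simp
  moreover have "\<P>(w in M. total_size n (\<lambda>j. \<xi> j w) = n) = prob (\<lambda>t. size t = n)"
    using prob_xi[of "\<lambda>t. size t = n"] by simp
  ultimately show ?thesis by (simp add: cond_prob_def)
qed

lemma sets_mu: "{\<sigma> \<in> space \<mu>. P \<sigma>} \<in> sets \<mu>"
proof -
  have "sets \<mu> = Pow (assemblies m n)" using weakly_log by (simp add: weakly_logarithmic_def)
  moreover from this have "space \<mu> = assemblies m n" by (metis Pow_top Pow_iff sets.sets_into_space sets.top subset_antisym)
  ultimately show ?thesis by auto
qed

lemma prob_space_mu: "prob_space \<mu>"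
  using weakly_log by (simp add: weakly_logarithmic_def)

text \<open>The defining property of a weakly logarithmic pair determines the law of the count vector
  pointwise; it extends to all events because the count vectors form a countable set.\<close>

lemma prob_comp_count:
  "\<P>(\<sigma> in \<mu>. Q (truncate n (\<lambda>j. comp_count j \<sigma>))) =
    prob (\<lambda>s. Q s \<and> size s = n) / prob (\<lambda>s. size s = n)"
proof -
  interpret mu: prob_space \<mu> by (rule prob_space_mu)
  let ?c = "cond_pmf law {s. size s = n}"
  have off: "t = truncate n t" if "t \<in> set_pmf law" for t
    using that unfolding law_def by (metis truncate_set_Pi_pmf)
  have "distr \<mu> (count_space UNIV) (\<lambda>\<sigma>. truncate n (\<lambda>j. comp_count j \<sigma>)) = measure_pmf ?c"
  proof (rule distr_truncate_eqI[OF sets_mu mu.finite_measure_axioms])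
    show "mu.prob {\<sigma> \<in> space \<mu>. \<forall>j\<in>{1..n}. comp_count j \<sigma> = s j} = pmf ?c (truncate n s)" for s
    proof -
      have "mu.prob {\<sigma> \<in> space \<mu>. \<forall>j\<in>{1..n}. comp_count j \<sigma> = s j}
          = prob (\<lambda>t. (\<forall>j\<in>{1..n}. t j = s j) \<and> size t = n) / prob (\<lambda>t. size t = n)"
        using weakly_log cond_prob_xi by (simp add: weakly_logarithmic_def)
      also have "prob (\<lambda>t. (\<forall>j\<in>{1..n}. t j = s j) \<and> size t = n)
          = measure_pmf.prob law (if size s = n then {truncate n s} else {})"
      proof (intro measure_eq_AE AE_pmfI)
        fix t assume "t \<in> set_pmf law"
        then have "t = truncate n t" by (rule off)
        then have "t = truncate n s \<longleftrightarrow> (\<forall>j\<in>{1..n}. t j = s j)" by (metis truncate_eq_iff)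
        moreover have "size t = size s" if "t = truncate n s" using that by simp
        ultimately show "t \<in> {t. (\<forall>j\<in>{1..n}. t j = s j) \<and> size t = n} \<longleftrightarrow>
            t \<in> (if size s = n then {truncate n s} else {})" by auto
      qed auto
      finally show ?thesis
        by (auto simp: pmf_cond[OF size_n_possible] measure_pmf_single)
    qed
    show "set_pmf ?c \<subseteq> range (truncate n)"
      using off by (auto simp: set_cond_pmf[OF size_n_possible])
  qed
  from prob_distr_truncate[OF sets_mu this, of Q]
  have "\<P>(\<sigma> in \<mu>. Q (truncate n (\<lambda>j. comp_count j \<sigma>))) = measure_pmf.prob ?c {s. Q s}" .
  also have "\<dots> = prob (\<lambda>s. Q s \<and> size s = n) / prob (\<lambda>s. size s = n)"
  proof -
    have "emeasure (measure_pmf law) {s. size s = n} \<noteq> 0"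
      using size_n_possible by (rule emeasure_measure_pmf_not_zero)
    then have "measure_pmf.prob ?c {s. Q s} = measure_pmf.prob law ({s. size s = n} \<inter> {s. Q s}) / prob (\<lambda>s. size s = n)"
      unfolding cond_pmf.rep_eq[OF size_n_possible] by (intro measure_uniform_measure) auto
    then show ?thesis by (simp add: Int_def conj_commute)
  qed
  finally show ?thesis .
qed

text \<open>The set \<open>K j\<close> consists of those \<open>k\<close> for which \<open>(j, k)\<close> is a breaking pair.\<close>

theorem additive_bound:
  fixes h :: "nat \<Rightarrow> nat \<Rightarrow> 'g::ab_group_add"
  assumes h0: "\<forall>j\<ge>1. h j 0 = 0"
  shows "\<P>(\<sigma> in \<mu>. additive_fun h n \<sigma> \<notin> plus_minus_set A)
    \<le> main_const * \<P>(w in M. (\<Sum>j=1..n. h j (\<xi> j w)) \<notin> A) powr min 1 \<theta>'"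
proof -
  define H where "H s = (\<Sum>j=1..n. h j (s j))" for s
  define K where "K j = {k. \<forall>t. t j = 0 \<longrightarrow> H t \<notin> A \<or> H (t(j := k)) \<notin> A}" for j
  have H_upd: "H (t(j := k)) = H t + h j k" if "j \<in> {1..n}" "t j = 0" for t j k
  proof -
    have "H (t(j := k)) = h j k + (\<Sum>i\<in>{1..n} - {j}. h i (t i))"
      unfolding H_def using that by (subst sum.remove[of _ j]) auto
    moreover have "H t = (\<Sum>i\<in>{1..n} - {j}. h i (t i))"
      unfolding H_def using that h0 by (subst sum.remove[of _ j]) auto
    ultimately show ?thesis by simp
  qed
  have "prob (\<lambda>s. H s \<notin> plus_minus_set A \<and> size s = n)
      \<le> main_const * prob (\<lambda>s. H s \<notin> A) powr min 1 \<theta>' * prob (\<lambda>s. size s = n)"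
  proof (rule conditional_bound[where K = K])
    fix s j assume j: "j \<in> {1..n}"
    show "H s \<notin> A \<or> H (s(j := 0)) \<notin> A" if k: "s j \<in> K j"
      using k unfolding K_def by (auto dest: spec[of _ "s(j := 0)"])
    show "H (s(j := 0)) \<notin> A" if k: "s j \<notin> K j" and far: "H s \<notin> plus_minus_set A"
    proof
      assume A: "H (s(j := 0)) \<in> A"
      obtain t where t: "t j = 0" "H t \<in> A" "H (t(j := s j)) \<in> A"
        using k by (auto simp: K_def)
      have "H s = H (s(j := 0)) + h j (s j)"
        using H_upd[OF j, of "s(j := 0)" "s j"] by simp
      then have "H s = H (s(j := 0)) + H (t(j := s j)) - H t"
        using H_upd[of j t "s j"] j t(1) by simp
      then have "H s \<in> plus_minus_set A"
        unfolding plus_minus_set_def using A t by blast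
      with far show False by simp
    qed
  qed
  moreover have "0 < prob (\<lambda>s. size s = n)"
    using prob_size_n_ge size_floor_pos n_pos by (auto simp: zero_less_mult_iff dest: less_le_trans)
  ultimately have "prob (\<lambda>s. H s \<notin> plus_minus_set A \<and> size s = n) / prob (\<lambda>s. size s = n)
      \<le> main_const * prob (\<lambda>s. H s \<notin> A) powr min 1 \<theta>'"
    by (simp add: pos_divide_le_eq)
  moreover have "\<P>(\<sigma> in \<mu>. additive_fun h n \<sigma> \<notin> plus_minus_set A)
      = prob (\<lambda>s. H s \<notin> plus_minus_set A \<and> size s = n) / prob (\<lambda>s. size s = n)"
    using prob_comp_count[of "\<lambda>s. H s \<notin> plus_minus_set A"] by (simp add: H_def additive_fun_def)
  moreover have "\<P>(w in M. (\<Sum>j=1..n. h j (\<xi> j w)) \<notin> A) = prob (\<lambda>s. H s \<notin> A)"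
    using prob_xi[of "\<lambda>s. H s \<notin> A"] by (simp add: H_def)
  ultimately show ?thesis by simp
qed

text \<open>The sample space can be replaced by \<open>nat \<Rightarrow> nat\<close> with the law of the counts, the random vector
  being given by the coordinates.\<close>

lemma weakly_log_law:
  "weakly_logarithmic \<theta>' \<theta>'' m n \<mu> (measure_pmf law) (\<lambda>j s. s j)"
proof -
  have marginal: "distr (measure_pmf law) (count_space UNIV) (\<lambda>s. s j) =
      measure_pmf (poisson_pmf (prob_space.expectation M (\<lambda>w. real (\<xi> j w))))" if "j \<in> {1..n}" for j
    using that Pi_pmf_component[of "{1..n}" j 0 "\<lambda>j. poisson_pmf (prob_space.expectation M (\<lambda>w. real (\<xi> j w)))"]
    unfolding map_pmf_rep_eq[symmetric] law_def by simp
  have "poisson_vector (measure_pmf law) n (\<lambda>j s. s j)"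
    unfolding poisson_vector_def
  proof (intro conjI ballI)
    show "prob_space.indep_vars (measure_pmf law) (\<lambda>_. count_space UNIV) (\<lambda>j s. s j) {1..n}"
      unfolding law_def by (rule indep_vars_Pi_pmf) simp
    show "\<exists>l>0. distr (measure_pmf law) (count_space UNIV) (\<lambda>s. s j) = measure_pmf (poisson_pmf l)"
      if j: "j \<in> {1..n}" for j
      using rate_pos[OF j] marginal[OF j] by blast
  qed (rule measure_pmf.prob_space_axioms)
  moreover have "measure_pmf.expectation law (\<lambda>s. real (s j)) = prob_space.expectation M (\<lambda>w. real (\<xi> j w))"
    if j: "j \<in> {1..n}" for j
  proof -
    have "measure_pmf.expectation law (\<lambda>s. real (s j))
        = integral\<^sup>L (distr (measure_pmf law) (count_space UNIV) (\<lambda>s. s j)) real"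
      by (subst integral_distr) auto
    then show ?thesis
      using has_bochner_integral_poisson[OF rate_pos[OF j]] by (simp add: marginal[OF j] has_bochner_integral_iff)
  qed
  ultimately show ?thesis
    using weakly_log cond_prob_xi by (simp add: weakly_logarithmic_def cond_prob_def)
qed

end

section \<open>One constant for all groups and sample spaces\<close>

text \<open>The universal additive function: the generators of the free abelian group are the pairs \<open>(j, k)\<close>,
  with those for \<open>k = 0\<close> identified with zero.\<close>

definition generator :: "nat \<Rightarrow> nat \<Rightarrow> (nat \<times> nat, int) poly_mapping" where
  "generator j k = (if k = 0 then 0 else Poly_Mapping.single (j, k) 1)"

lemma lookup_sum_generator:
  assumes "i \<in> {1..n}" "k \<noteq> 0"
  shows "Poly_Mapping.lookup (\<Sum>j=1..n. generator j (s j)) (i, k) = of_bool (s i = k)"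
proof -
  have "Poly_Mapping.lookup (\<Sum>j=1..n. generator j (s j)) (i, k)
      = (\<Sum>j=1..n. if j = i then of_bool (s i = k) else 0)"
    unfolding lookup_sum using assms
    by (intro sum.cong) (auto simp: generator_def lookup_single when_def)
  then show ?thesis using assms by simp
qed

text \<open>The multiplicity of 0 is determined by the other multiplicities, since both sides have two
  members.\<close>

lemma pair_counts_eq:
  fixes p q r t :: nat
  assumes count: "\<And>k. k \<noteq> 0 \<Longrightarrow> (of_bool (p = k) + of_bool (q = k) :: int) = of_bool (r = k) + of_bool (t = k)"
  shows "p = r \<and> q = t \<or> p = t \<and> q = r"
proof -
  have single: "x = y" if "\<And>k. k \<noteq> 0 \<Longrightarrow> (of_bool (x = k) :: int) = of_bool (y = k)" for x y :: nat
    using that[of x] that[of y] by (auto split: if_splits)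
  consider "p = r" | "p = t" | "p \<noteq> r" "p \<noteq> t" by blast
  then show ?thesis
  proof cases
    case 1
    with count have "q = t" by (intro single) simp
    with 1 show ?thesis by simp
  next
    case 2
    with count have "q = r" by (intro single) simp
    with 2 show ?thesis by simp
  next
    case 3
    then have "p = 0" using count[of p] by (cases "p = 0"; cases "q = p") auto
    with 3 have "q = r" using count[of r] by (cases "q = r"; cases "t = r") auto
    moreover from 3 \<open>p = 0\<close> have "q = t" using count[of t] by (cases "q = t"; cases "r = t") auto
    ultimately
    show ?thesis using count[of q] 3 \<open>p = 0\<close> by auto
  qed
qed

text \<open>A relation in the free abelian group can be read off coordinate by coordinate: for each \<open>j\<close> it
  says that \<open>s j\<close>, \<open>u j\<close> and \<open>t j\<close>, \<open>v j\<close> are the same two numbers up to order.\<close>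

lemma generator_relation:
  fixes h :: "nat \<Rightarrow> nat \<Rightarrow> 'g::ab_group_add"
  assumes eq: "(\<Sum>j=1..n. generator j (s j)) + (\<Sum>j=1..n. generator j (u j)) =
      (\<Sum>j=1..n. generator j (t j)) + (\<Sum>j=1..n. generator j (v j))"
  shows "(\<Sum>j=1..n. h j (s j)) + (\<Sum>j=1..n. h j (u j)) = (\<Sum>j=1..n. h j (t j)) + (\<Sum>j=1..n. h j (v j))"
proof -
  have "h j (s j) + h j (u j) = h j (t j) + h j (v j)" if j: "j \<in> {1..n}" for j
  proof -
    have count: "(of_bool (s j = k) + of_bool (u j = k) :: int) = of_bool (t j = k) + of_bool (v j = k)"
      if "k \<noteq> 0" for k
      using arg_cong[OF eq, of "\<lambda>x. Poly_Mapping.lookup x (j, k)"]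
      by (simp only: lookup_add lookup_sum_generator[OF j that])
    from pair_counts_eq[OF count] show ?thesis by (auto simp: add.commute)
  qed
  then show ?thesis unfolding sum.distrib[symmetric] by (rule sum.cong[OF refl])
qed

text \<open>Since \<open>main_const\<close> depends on \<open>\<theta>'\<close> and \<open>\<theta>''\<close> only, it witnesses that the number chosen by
  \<open>bound_constant\<close> exists.\<close>

lemma bound_constant_bound:
  fixes h :: "nat \<Rightarrow> nat \<Rightarrow> (nat \<times> nat, int) poly_mapping" and M :: "(nat \<Rightarrow> nat) measure"
  assumes "0 < \<theta>'" "1 \<le> n" "weakly_logarithmic \<theta>' \<theta>'' m n \<mu> M \<xi>" "\<forall>j\<ge>1. h j 0 = 0"
  shows "\<P>(\<sigma> in \<mu>. additive_fun h n \<sigma> \<notin> plus_minus_set A)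
    \<le> bound_constant \<theta>' \<theta>'' * (\<P>(w in M. (\<Sum>j=1..n. h j (\<xi> j w)) \<notin> A) powr min 1 \<theta>' +
      of_bool (min 1 \<theta>' < 1) * real n powr (- min 1 \<theta>'))"
proof -
  define admissible :: "real \<Rightarrow> bool" where "admissible C \<longleftrightarrow>
     (\<forall>n\<ge>1. \<forall>m \<mu>. \<forall>(M :: (nat \<Rightarrow> nat) measure) \<xi>.
     \<forall>(h :: nat \<Rightarrow> nat \<Rightarrow> (nat \<times> nat, int) poly_mapping) A.
       weakly_logarithmic \<theta>' \<theta>'' m n \<mu> M \<xi> \<longrightarrow> (\<forall>j\<ge>1. h j 0 = 0) \<longrightarrow>
       \<P>(\<sigma> in \<mu>. additive_fun h n \<sigma> \<notin> plus_minus_set A)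
         \<le> C * (\<P>(w in M. (\<Sum>j=1..n. h j (\<xi> j w)) \<notin> A) powr min 1 \<theta>' +
                of_bool (min 1 \<theta>' < 1) * real n powr (- min 1 \<theta>')))" for C
  have "admissible (poisson_counts.main_const \<theta>' \<theta>'')"
    unfolding admissible_def
  proof (intro allI impI)
    fix n :: nat and m \<mu> and M :: "(nat \<Rightarrow> nat) measure" and \<xi>
      and h :: "nat \<Rightarrow> nat \<Rightarrow> (nat \<times> nat, int) poly_mapping" and A
    assume n: "n \<ge> 1" and wl: "weakly_logarithmic \<theta>' \<theta>'' m n \<mu> M \<xi>" and h0: "\<forall>j\<ge>1. h j 0 = 0"
    interpret weakly_log \<theta>' \<theta>'' m n \<mu> M \<xi>
      using assms(1) n wl by unfold_locales
    have "\<P>(\<sigma> in \<mu>. additive_fun h n \<sigma> \<notin> plus_minus_set A)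
        \<le> main_const * (\<P>(w in M. (\<Sum>j=1..n. h j (\<xi> j w)) \<notin> A) powr min 1 \<theta>' + 0)"
      using additive_bound[of h A] h0 by simp
    also have "\<dots> \<le> main_const * (\<P>(w in M. (\<Sum>j=1..n. h j (\<xi> j w)) \<notin> A) powr min 1 \<theta>' +
        of_bool (min 1 \<theta>' < 1) * real n powr (- min 1 \<theta>'))"
      by (intro mult_left_mono add_left_mono main_const_nonneg) auto
    finally show "\<P>(\<sigma> in \<mu>. additive_fun h n \<sigma> \<notin> plus_minus_set A)
        \<le> main_const * (\<P>(w in M. (\<Sum>j=1..n. h j (\<xi> j w)) \<notin> A) powr min 1 \<theta>' +
        of_bool (min 1 \<theta>' < 1) * real n powr (- min 1 \<theta>'))" .
  qed
  then have "admissible (SOME C. admissible C)" by (rule someI)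
  then have "admissible (bound_constant \<theta>' \<theta>'')"
    unfolding bound_constant_def admissible_def .
  then show ?thesis
    using assms(2-4) unfolding admissible_def by blast
qed

theorem corollary1:
  fixes \<theta> \<theta>' \<theta>'' :: real
    and n :: nat
    and m :: "nat \<Rightarrow> nat"
    and \<mu> :: "assembly measure"
    and M :: "'w measure"
    and \<xi> :: "nat \<Rightarrow> 'w \<Rightarrow> nat"
    and h :: "nat \<Rightarrow> nat \<Rightarrow> 'g::ab_group_add"
    and A :: "'g set"
  assumes "0 < \<theta>'" "\<theta>' \<le> \<theta>''" "\<theta> = min 1 \<theta>'"
    and "1 \<le> n"
    and "weakly_logarithmic \<theta>' \<theta>'' m n \<mu> M \<xi>"
    and "\<forall>j\<ge>1. h j 0 = 0"
  shows "\<P>(\<sigma> in \<mu>. additive_fun h n \<sigma> \<notin> plus_minus_set A)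
    \<le> bound_constant \<theta>' \<theta>'' *
        (\<P>(w in M. (\<Sum>j=1..n. h j (\<xi> j w)) \<notin> A) powr \<theta> +
         of_bool (\<theta> < 1) * real n powr (- \<theta>))"
proof -
  interpret weakly_log \<theta>' \<theta>'' m n \<mu> M \<xi>
    using assms by unfold_locales
  interpret mu: prob_space \<mu> by (rule prob_space_mu)
  define H where "H s = (\<Sum>j=1..n. h j (s j))" for s
  define G where "G s = (\<Sum>j=1..n. generator j (s j))" for s
  \<comment> \<open>Each element of \<open>B\<close> comes with a configuration, so that a relation between elements of \<open>B\<close> in the
    free abelian group carries over to values of \<open>H\<close> in \<open>A\<close>.\<close>
  define B where "B = G ` {s. H s \<in> A}"
  have rel: "H s + H u = H t + H v" if "G s + G u = G t + G v" for s t u v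
    using generator_relation[of s n u t v h] that unfolding H_def G_def by blast
  have G_inj: "H s = H t" if "G s = G t" for s t
    using rel[of s s t s] that by simp
  have in_B: "G s \<in> B \<longleftrightarrow> H s \<in> A" for s
    unfolding B_def by (metis (mono_tags, lifting) G_inj image_iff mem_Collect_eq)
  have far: "H s \<in> plus_minus_set A" if near: "G s \<in> plus_minus_set B" for s
  proof -
    obtain t v u where tvu: "G s = G t + G v - G u" "H t \<in> A" "H v \<in> A" "H u \<in> A"
      using near unfolding plus_minus_set_def B_def by auto
    then have "H s + H u = H t + H v" by (intro rel) simp
    then have "H s = H t + H v - H u" by (simp add: algebra_simps)
    with tvu show ?thesis unfolding plus_minus_set_def by blast
  qed
  have "\<P>(\<sigma> in \<mu>. additive_fun h n \<sigma> \<notin> plus_minus_set A)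
      \<le> \<P>(\<sigma> in \<mu>. additive_fun generator n \<sigma> \<notin> plus_minus_set B)"
    using far by (intro mu.finite_measure_mono sets_mu) (auto simp: additive_fun_def H_def G_def)
  also have "\<dots> \<le> bound_constant \<theta>' \<theta>'' *
      (\<P>(s in measure_pmf law. (\<Sum>j=1..n. generator j (s j)) \<notin> B) powr min 1 \<theta>' +
      of_bool (min 1 \<theta>' < 1) * real n powr (- min 1 \<theta>'))"
    by (rule bound_constant_bound[OF _ _ weakly_log_law]) (use assms in \<open>auto simp: generator_def\<close>)
  also have "\<P>(s in measure_pmf law. (\<Sum>j=1..n. generator j (s j)) \<notin> B) = prob (\<lambda>s. H s \<notin> A)"
    using in_B unfolding G_def by simp
  also have "prob (\<lambda>s. H s \<notin> A) = \<P>(w in M. (\<Sum>j=1..n. h j (\<xi> j w)) \<notin> A)"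
    using prob_xi[of "\<lambda>s. H s \<notin> A"] by (simp add: H_def)
  finally show ?thesis using assms(3) by simp
qed

end
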